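(* For all $\widetilde{x}\in\widetilde{\mathbb{R}^n}$ there exists $v\in\mathcal{G}_{\mathscr{S}}(\mathbb{R}^n)$ such that for all $u\in\mathcal{G}_\tau^{\infty,\infty}(\mathbb{R}^n)$ $$u(\widetilde{x})=\int_{\mathbb{R}^n}v(y)u(y)\,dy\qquad\text{in }\widetilde{\mathbb{C}}.$$
   Context: All nets are indexed by $\varepsilon\in(0,1]$ and $O$-estimates are for $\varepsilon\to0$. $\widetilde{\mathbb{C}}$ is the ring of nets $(z_\varepsilon)_\varepsilon\in\mathbb{C}^{(0,1]}$ with $|z_\varepsilon|=O(\varepsilon^{-N})$ for some $N\in\mathbb{N}$, modulo the nets with $|z_\varepsilon|=O(\varepsilon^q)$ for all $q\in\mathbb{N}$. $\widetilde{\mathbb{R}^n}$ is the set of nets $(x_\varepsilon)_\varepsilon\in(\mathbb{R}^n)^{(0,1]}$ with $|x_\varepsilon|=O(\varepsilon^{-N})$ for some $N$, modulo $(x_\varepsilon)_\varepsilon\sim(y_\varepsilon)_\varepsilon$ iff $|x_\varepsilon-y_\varepsilon|=O(\varepsilon^q)$ for all $q\in\mathbb{N}$. $\mathcal{G}_{\mathscr{S}}(\mathbb{R}^n)=\mathcal{E}_{\mathscr{S}}(\mathbb{R}^n)/\mathcal{N}_{\mathscr{S}}(\mathbb{R}^n)$, where, with $p_j(f)=\sup_{x\in\mathbb{R}^n,|\alpha|\le j}(1+|x|)^j|\partial^\alpha f(x)|$, $\mathcal{E}_{\mathscr{S}}(\mathbb{R}^n)$ is the set of nets $(u_\varepsilon)_\varepsilon\in\mathscr{S}(\mathbb{R}^n)^{(0,1]}$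 such that for all $j\in\mathbb{N}$ there is $N\in\mathbb{N}$ with $p_j(u_\varepsilon)=O(\varepsilon^{-N})$, and $\mathcal{N}_{\mathscr{S}}(\mathbb{R}^n)$ is the set of nets with $p_j(u_\varepsilon)=O(\varepsilon^q)$ for all $j,q\in\mathbb{N}$. $\mathcal{G}_\tau(\mathbb{R}^n)=\mathcal{E}_\tau(\mathbb{R}^n)/\mathcal{N}_\tau(\mathbb{R}^n)$, where $\mathcal{E}_\tau(\mathbb{R}^n)$ is the set of nets $(u_\varepsilon)_\varepsilon\in\mathcal{O}_M(\mathbb{R}^n)^{(0,1]}$ such that for all $\alpha\in\mathbb{N}^n$ there is $N\in\mathbb{N}$ with $\sup_{x\in\mathbb{R}^n}(1+|x|)^{-N}|\partial^\alpha u_\varepsilon(x)|=O(\varepsilon^{-N})$, and $\mathcal{N}_\tau(\mathbb{R}^n)$ is the set of nets such that for all $\alpha$ there is $N\in\mathbb{N}$ such that for all $q\in\mathbb{N}$, $\sup_{x\in\mathbb{R}^n}(1+|x|)^{-N}|\partial^\alpha u_\varepsilon(x)|=O(\varepsilon^{q})$. Here $\mathcal{O}_M(\mathbb{R}^n)$ is the space of smooth functions all of whose derivatives have at most polynomial growth. $\mathcal{G}_\tau^{\infty,\infty}(\mathbb{R}^n)$ is the subalgebra of those elements of $\mathcal{G}_\tau(\mathbb{R}^n)$ having a representative $(u_\varepsilon)_\varepsilon\in\mathcal{E}_\tau^{\infty,\infty}(\mathbb{R}^n)$, i.e. such that there exists $N\in\mathbb{N}$ such that for all $\alpha\in\mathbb{N}^n$,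 $\sup_{x\in\mathbb{R}^n}(1+|x|)^{-N}|\partial^\alpha u_\varepsilon(x)|=O(\varepsilon^{-N})$. For $u\in\mathcal{G}_\tau(\mathbb{R}^n)$ and $\widetilde{x}=[(x_\varepsilon)_\varepsilon]\in\widetilde{\mathbb{R}^n}$, $u(\widetilde{x}):=[(u_\varepsilon(x_\varepsilon))_\varepsilon]\in\widetilde{\mathbb{C}}$ is well defined. For $v\in\mathcal{G}_{\mathscr{S}}(\mathbb{R}^n)$ and $u\in\mathcal{G}_\tau(\mathbb{R}^n)$ the product $vu:=[(v_\varepsilon u_\varepsilon)_\varepsilon]\in\mathcal{G}_{\mathscr{S}}(\mathbb{R}^n)$ is well defined, and for $w\in\mathcal{G}_{\mathscr{S}}(\mathbb{R}^n)$, $\int_{\mathbb{R}^n}w(y)\,dy:=[(\int_{\mathbb{R}^n}w_\varepsilon(y)\,dy)_\varepsilon]\in\widetilde{\mathbb{C}}$. *)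

theory Defs
  imports "HOL-Analysis.Analysis" "HOL-Library.Landau_Symbols"
begin

text \<open>
  Conventions. A net indexed by \<open>(0,1]\<close> is a function on \<open>real\<close> whose values outside \<open>{0<..1}\<close>
  are irrelevant: no condition below looks at them, and two nets that agree on \<open>{0<..1}\<close> are
  always equivalent. Hence the quotients are (in canonical bijection with) those of nets on
  \<open>{0<..1}\<close>. Generalized points and functions are equivalence classes, elements of \<open>E // R\<close>;
  operations on classes are given as unions over representatives, as is usual with
  \<open>HOL.Equiv_Relations\<close>. Estimates as \<open>\<epsilon> \<rightarrow> 0\<close> are along the filter \<open>at_right 0\<close>.
\<close>

section \<open>Generalized numbers and points\<close>

definition moderate_nets :: "(real \<Rightarrow> 'a::real_normed_vector) set" where
  "moderate_nets =
     {x. \<exists>N::nat. (\<lambda>\<epsilon>. norm (x \<epsilon>)) \<in> O[at_right 0](\<lambda>\<epsilon>. \<epsilon> powi (- int N))}"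

definition negligible_nets :: "(real \<Rightarrow> 'a::real_normed_vector) set" where
  "negligible_nets =
     {x. \<forall>q::nat. (\<lambda>\<epsilon>. norm (x \<epsilon>)) \<in> O[at_right 0](\<lambda>\<epsilon>. \<epsilon> ^ q)}"

definition net_rel :: "((real \<Rightarrow> 'a::real_normed_vector) \<times> (real \<Rightarrow> 'a)) set" where
  "net_rel = {(x, y). x \<in> moderate_nets \<and> y \<in> moderate_nets \<and>
                      (\<lambda>\<epsilon>. x \<epsilon> - y \<epsilon>) \<in> negligible_nets}"

definition C_tilde :: "(real \<Rightarrow> complex) set set" where
  "C_tilde = moderate_nets // net_rel"

definition Rn_tilde :: "(real \<Rightarrow> real ^ 'n) set set" where
  "Rn_tilde = moderate_nets // net_rel"


section \<open>Partial derivatives and smooth functions\<close>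

definition partial_deriv :: "'n \<Rightarrow> (real ^ 'n \<Rightarrow> complex) \<Rightarrow> real ^ 'n \<Rightarrow> complex" where
  "partial_deriv i f x = vector_derivative (\<lambda>t. f (x + t *\<^sub>R axis i 1)) (at 0)"

text \<open>
  All iterated partial derivatives, in any order of the coordinates, are (totally) differentiable.
  This is \<open>C\<^sup>\<infinity>\<close>: total differentiability makes every iterated partial derivative exist and be
  continuous, and conversely continuous partial derivatives give total differentiability.
\<close>

definition smooth :: "(real ^ 'n \<Rightarrow> complex) \<Rightarrow> bool" where
  "smooth f \<longleftrightarrow> (\<forall>is. foldr partial_deriv is f differentiable_on UNIV)"

text \<open>
  A multi-index is a function \<open>\<alpha> :: 'n \<Rightarrow> nat\<close>. As the index type carries no order, the
  coordinates are composed along a fixed enumeration of it; on smooth functions the result does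
  not depend on the enumeration.
\<close>

definition mindex_abs :: "('n::finite \<Rightarrow> nat) \<Rightarrow> nat" where
  "mindex_abs \<alpha> = (\<Sum>i\<in>UNIV. \<alpha> i)"

definition coords :: "'n::finite list" where
  "coords = (SOME is. set is = UNIV \<and> distinct is)"

definition multi_deriv :: "('n \<Rightarrow> nat) \<Rightarrow> (real ^ 'n \<Rightarrow> complex) \<Rightarrow> real ^ 'n \<Rightarrow> complex" where
  "multi_deriv \<alpha> f = foldr (\<lambda>i. partial_deriv i ^^ \<alpha> i) coords f"


section \<open>Seminorms\<close>

text \<open>
  The suprema may be infinite, so they are formed in \<open>ennreal\<close>. An \<open>O\<close>-estimate on such a net
  includes its finiteness for small \<open>\<epsilon>\<close>.
\<close>

definition bigO_net :: "(real \<Rightarrow> ennreal) \<Rightarrow> int \<Rightarrow> bool" where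
  "bigO_net p k \<longleftrightarrow> (\<forall>\<^sub>F \<epsilon> in at_right 0. p \<epsilon> < \<infinity>) \<and>
                     (\<lambda>\<epsilon>. enn2real (p \<epsilon>)) \<in> O[at_right 0](\<lambda>\<epsilon>. \<epsilon> powi k)"

definition schwartz_seminorm :: "nat \<Rightarrow> (real ^ 'n \<Rightarrow> complex) \<Rightarrow> ennreal" where
  "schwartz_seminorm j f =
     (SUP \<alpha>\<in>{\<alpha>. mindex_abs \<alpha> \<le> j}. SUP x.
        ennreal ((1 + norm x) ^ j * norm (multi_deriv \<alpha> f x)))"

definition tempered_seminorm ::
    "nat \<Rightarrow> ('n \<Rightarrow> nat) \<Rightarrow> (real ^ 'n \<Rightarrow> complex) \<Rightarrow> ennreal" where
  "tempered_seminorm N \<alpha> f =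
     (SUP x. ennreal ((1 + norm x) powi (- int N) * norm (multi_deriv \<alpha> f x)))"


section \<open>The algebra of generalized functions based on the Schwartz space\<close>

definition schwartz_space :: "(real ^ 'n \<Rightarrow> complex) set" where
  "schwartz_space = {f. smooth f \<and> (\<forall>j. schwartz_seminorm j f < \<infinity>)}"

definition E_S :: "(real \<Rightarrow> real ^ 'n \<Rightarrow> complex) set" where
  "E_S = {u. (\<forall>\<epsilon>\<in>{0<..1}. u \<epsilon> \<in> schwartz_space) \<and>
             (\<forall>j. \<exists>N::nat. bigO_net (\<lambda>\<epsilon>. schwartz_seminorm j (u \<epsilon>)) (- int N))}"

definition N_S :: "(real \<Rightarrow> real ^ 'n \<Rightarrow> complex) set" where
  "N_S = {u. (\<forall>\<epsilon>\<in>{0<..1}. u \<epsilon> \<in> schwartz_space) \<and>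
             (\<forall>j. \<forall>q::nat. bigO_net (\<lambda>\<epsilon>. schwartz_seminorm j (u \<epsilon>)) (int q))}"

definition S_rel ::
    "((real \<Rightarrow> real ^ 'n \<Rightarrow> complex) \<times> (real \<Rightarrow> real ^ 'n \<Rightarrow> complex)) set" where
  "S_rel = {(u, v). u \<in> E_S \<and> v \<in> E_S \<and> (\<lambda>\<epsilon> x. u \<epsilon> x - v \<epsilon> x) \<in> N_S}"

definition G_S :: "(real \<Rightarrow> real ^ 'n \<Rightarrow> complex) set set" where
  "G_S = E_S // S_rel"


section \<open>The algebra of tempered generalized functions\<close>

definition O_M :: "(real ^ 'n \<Rightarrow> complex) set" where
  "O_M = {f. smooth f \<and> (\<forall>\<alpha>. \<exists>N. tempered_seminorm N \<alpha> f < \<infinity>)}"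

definition E_tau :: "(real \<Rightarrow> real ^ 'n \<Rightarrow> complex) set" where
  "E_tau = {u. (\<forall>\<epsilon>\<in>{0<..1}. u \<epsilon> \<in> O_M) \<and>
               (\<forall>\<alpha>. \<exists>N::nat. bigO_net (\<lambda>\<epsilon>. tempered_seminorm N \<alpha> (u \<epsilon>)) (- int N))}"

definition N_tau :: "(real \<Rightarrow> real ^ 'n \<Rightarrow> complex) set" where
  "N_tau = {u. (\<forall>\<epsilon>\<in>{0<..1}. u \<epsilon> \<in> O_M) \<and>
               (\<forall>\<alpha>. \<exists>N::nat. \<forall>q::nat.
                  bigO_net (\<lambda>\<epsilon>. tempered_seminorm N \<alpha> (u \<epsilon>)) (int q))}"

definition tau_rel ::
    "((real \<Rightarrow> real ^ 'n \<Rightarrow> complex) \<times> (real \<Rightarrow> real ^ 'n \<Rightarrow> complex)) set" where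
  "tau_rel = {(u, v). u \<in> E_tau \<and> v \<in> E_tau \<and> (\<lambda>\<epsilon> x. u \<epsilon> x - v \<epsilon> x) \<in> N_tau}"

definition G_tau :: "(real \<Rightarrow> real ^ 'n \<Rightarrow> complex) set set" where
  "G_tau = E_tau // tau_rel"

text \<open>In contrast to \<open>E_tau\<close>, here \<open>N\<close> is uniform in \<open>\<alpha>\<close>.\<close>

definition E_tau_inf_inf :: "(real \<Rightarrow> real ^ 'n \<Rightarrow> complex) set" where
  "E_tau_inf_inf = {u. (\<forall>\<epsilon>\<in>{0<..1}. u \<epsilon> \<in> O_M) \<and>
     (\<exists>N::nat. \<forall>\<alpha>. bigO_net (\<lambda>\<epsilon>. tempered_seminorm N \<alpha> (u \<epsilon>)) (- int N))}"

definition G_tau_inf_inf :: "(real \<Rightarrow> real ^ 'n \<Rightarrow> complex) set set" where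
  "G_tau_inf_inf = {U \<in> G_tau. \<exists>u\<in>U. u \<in> E_tau_inf_inf}"


section \<open>Point values, products and integrals\<close>

definition point_value ::
    "(real \<Rightarrow> real ^ 'n \<Rightarrow> complex) set \<Rightarrow> (real \<Rightarrow> real ^ 'n) set \<Rightarrow> (real \<Rightarrow> complex) set" where
  "point_value U X = (\<Union>u\<in>U. \<Union>x\<in>X. net_rel `` {\<lambda>\<epsilon>. u \<epsilon> (x \<epsilon>)})"

definition GS_mult ::
    "(real \<Rightarrow> real ^ 'n \<Rightarrow> complex) set \<Rightarrow> (real \<Rightarrow> real ^ 'n \<Rightarrow> complex) set
      \<Rightarrow> (real \<Rightarrow> real ^ 'n \<Rightarrow> complex) set" where
  "GS_mult V U = (\<Union>v\<in>V. \<Union>u\<in>U. S_rel `` {\<lambda>\<epsilon> y. v \<epsilon> y * u \<epsilon> y})"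

definition GS_integral :: "(real \<Rightarrow> real ^ 'n \<Rightarrow> complex) set \<Rightarrow> (real \<Rightarrow> complex) set" where
  "GS_integral W = (\<Union>w\<in>W. net_rel `` {\<lambda>\<epsilon>. LINT y|lborel. w \<epsilon> y})"

end

theory Submission
  imports Defs "HOL-Probability.Sinc_Integral"
begin

text \<open>
  Let \<open>\<rho>\<close> be a Gaussian with integral \<open>1\<close> and let \<open>\<rho>\<^sub>h\<close> be \<open>\<rho>\<close> rescaled to width \<open>h\<close> and centred
  at \<open>x\<^sub>\<epsilon>\<close>. The net \<open>v\<^sub>\<epsilon>\<close> is the Richardson extrapolation
  \<open>\<Sum>k=1..M. (-1)^(k+1) (M choose k) \<rho>\<^bsub>k\<epsilon>\<^esub>\<close>, so that \<open>u(x\<^sub>\<epsilon>) - \<integral> v\<^sub>\<epsilon> u\<close> is, up to sign, the integral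
  over \<open>\<rho>(z) dz\<close> of the \<open>M\<close>-th difference with step \<open>\<epsilon>\<close> of \<open>t \<mapsto> u(x\<^sub>\<epsilon> + t z)\<close> at \<open>0\<close>.
  For \<open>q \<le> M\<close> this difference is at most \<open>2^M \<epsilon>^q\<close> times a bound for the derivatives of
  order \<open>q\<close>. With \<open>M = \<lfloor>log\<^sub>2 (1/\<epsilon>)\<rfloor>\<close> the loss \<open>2^M\<close> is at most \<open>1/\<epsilon>\<close>, while every \<open>q\<close> is
  eventually admissible. Since the derivatives of \<open>u\<^sub>\<epsilon>\<close> have growth \<open>\<epsilon>^(-N)\<close> with \<open>N\<close> independent
  of the order, the error is negligible. No vanishing moments of \<open>\<rho>\<close> are needed.
\<close>

section \<open>Iterated partial derivatives\<close>

text \<open>The net \<open>v\<close> has to be fixed before \<open>u\<close> is known, hence before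
  the growth exponent and the required accuracy are. Extrapolation of a fixed order would guarantee
  only a fixed power of \<epsilon>, so the order has to grow as \<epsilon> tends to 0. On the other
  hand the coefficients, whose absolute values sum to less than 2^M, must stay moderate for
  \<open>v\<close> to be a generalized function at all. Logarithmic growth reconciles the two
  demands. It also keeps all widths k\<epsilon> at most 1, so that every difference is formed on the
  segment from x to x + z, where growth in x and growth in z can be separated. A second obstacle
  lies in the quotients. Operations on classes are unions over representatives, so the equality has
  to be checked for every choice of representatives, although a single representative of
  \<open>U\<close> is known to be regular. Derivative estimates are taken from that one alone; the
  others are compared with it through values and integrals.\<close>

abbreviation iter_partial :: "'n list \<Rightarrow> (real ^ 'n \<Rightarrow> complex) \<Rightarrow> real ^ 'n \<Rightarrow> complex" where
  "iter_partial xs f \<equiv> foldr partial_deriv xs f"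

section \<open>Derivatives along lines and smooth functions\<close>

lemma has_derivative_imp_line:
  fixes f :: "real ^ 'n \<Rightarrow> complex"
  assumes "(f has_derivative D) (at (x + t *\<^sub>R z))"
  shows "((\<lambda>t. f (x + t *\<^sub>R z)) has_vector_derivative D z) (at t)"
proof -
  have "((\<lambda>t. x + t *\<^sub>R z) has_derivative (\<lambda>s. s *\<^sub>R z)) (at t)"
    by (auto intro!: derivative_eq_intros)
  from has_derivative_compose[OF this assms]
  have "((\<lambda>t. f (x + t *\<^sub>R z)) has_derivative (\<lambda>s. D (s *\<^sub>R z))) (at t)" .
  moreover have "D (s *\<^sub>R z) = s *\<^sub>R D z" for s
    using assms has_derivative_linear linear_cmul by blast
  ultimately show ?thesis
    by (simp add: has_vector_derivative_def)
qed

lemma partial_deriv_eq: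
  fixes f :: "real ^ 'n \<Rightarrow> complex"
  assumes "(f has_derivative D) (at x)"
  shows "partial_deriv i f x = D (axis i 1)"
  unfolding partial_deriv_def
  by (rule vector_derivative_at) (rule has_derivative_imp_line, simp add: assms)

lemma smooth_differentiable: "smooth f \<Longrightarrow> f differentiable (at x)"
  unfolding smooth_def by (metis UNIV_I differentiable_on_def foldr.simps(1) id_apply)

lemma smooth_partial: "smooth f \<Longrightarrow> smooth (partial_deriv i f)"
  unfolding smooth_def
proof
  fix xs assume "\<forall>xs. foldr partial_deriv xs f differentiable_on UNIV"
  then have "foldr partial_deriv (xs @ [i]) f differentiable_on UNIV" by blast
  then show "foldr partial_deriv xs (partial_deriv i f) differentiable_on UNIV" by simp
qed

lemma smooth_iter: "smooth f \<Longrightarrow> smooth (iter_partial xs f)"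
  by (induction xs) (auto intro: smooth_partial)

text \<open>Smoothness quantifies over all iterated partial derivatives, which seldom have a usable
  closed form. It is enough to find a class \<open>P\<close> of differentiable functions that is
  stable under partial derivatives. Constants, sums of products and polynomials times a Gaussian are
  treated in this way.\<close>

lemma smooth_coinduct:
  assumes "P f" and "\<And>g x. P g \<Longrightarrow> g differentiable (at x)" and "\<And>g i. P g \<Longrightarrow> P (partial_deriv i g)"
  shows "smooth f"
proof -
  have "P (iter_partial xs f)" for xs
    by (induction xs) (auto intro: assms)
  then show ?thesis
    unfolding smooth_def differentiable_on_def by (auto intro: assms(2) differentiable_at_withinI)
qed

lemma smooth_has_derivative:
  fixes f :: "real ^ 'n \<Rightarrow> complex"
  assumes "smooth f"
  shows "(f has_derivative (\<lambda>h. \<Sum>i\<in>UNIV. h $ i *\<^sub>R partial_deriv i f x)) (at x)"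
proof -
  obtain D where D: "(f has_derivative D) (at x)"
    using smooth_differentiable[OF assms] by (auto simp: differentiable_def)
  have "D h = (\<Sum>i\<in>UNIV. h $ i *\<^sub>R partial_deriv i f x)" for h
  proof -
    have "D h = D (\<Sum>i\<in>UNIV. h $ i *\<^sub>R axis i 1)"
      using basis_expansion[of h] by (simp add: scalar_mult_eq_scaleR)
    also have "\<dots> = (\<Sum>i\<in>UNIV. h $ i *\<^sub>R D (axis i 1))"
      using has_derivative_linear[OF D] by (simp add: linear_sum linear_cmul)
    finally show ?thesis by (simp add: partial_deriv_eq[OF D])
  qed
  then have "D = (\<lambda>h. \<Sum>i\<in>UNIV. h $ i *\<^sub>R partial_deriv i f x)" by (rule ext)
  with D show ?thesis by simp
qed

lemma smooth_line:
  fixes f :: "real ^ 'n \<Rightarrow> complex"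
  assumes "smooth f"
  shows "((\<lambda>t. f (x + t *\<^sub>R z)) has_vector_derivative (\<Sum>i\<in>UNIV. z $ i *\<^sub>R partial_deriv i f (x + t *\<^sub>R z))) (at t)"
  by (rule has_derivative_imp_line[OF smooth_has_derivative[OF assms]])

lemma smooth_line_axis:
  fixes f :: "real ^ 'n \<Rightarrow> complex"
  assumes "smooth f"
  shows "((\<lambda>t. f (x + t *\<^sub>R axis i 1)) has_vector_derivative partial_deriv i f (x + t *\<^sub>R axis i 1)) (at t)"
proof -
  obtain D where D: "(f has_derivative D) (at (x + t *\<^sub>R axis i 1))"
    using smooth_differentiable[OF assms] by (auto simp: differentiable_def)
  show ?thesis
    using has_derivative_imp_line[OF D] partial_deriv_eq[OF D] by metis
qed

lemma smooth_continuous_on: 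
  fixes f :: "real ^ 'n \<Rightarrow> complex"
  shows "smooth f \<Longrightarrow> continuous_on S f"
  using continuous_at_imp_continuous_on differentiable_imp_continuous_within smooth_differentiable by blast

lemma smooth_continuous_compose:
  fixes f :: "real ^ 'n \<Rightarrow> complex"
  shows "smooth f \<Longrightarrow> continuous_on S g \<Longrightarrow> continuous_on S (\<lambda>x. f (g x))"
  by (rule continuous_on_compose2[OF smooth_continuous_on]) auto

text \<open>Symmetry of mixed derivatives by differentiation under the integral sign: write f at
  \<open>p s t\<close> as its value at s = 0 plus the integral of its i-th partial derivative,
  differentiate in t, and then differentiate the resulting integral in its upper limit s. Continuity
  of the second derivatives justifies both steps.\<close>

lemma partial_deriv_commute:
  fixes f :: "real ^ 'n \<Rightarrow> complex"
  assumes "smooth f"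
  shows "partial_deriv i (partial_deriv j f) = partial_deriv j (partial_deriv i f)"
proof
  fix x
  define p where "p s t = x + s *\<^sub>R axis i 1 + t *\<^sub>R axis j (1::real)" for s t
  note sm = assms smooth_partial[OF assms] smooth_partial[OF smooth_partial[OF assms]]
  have p_eq: "x + t *\<^sub>R axis j 1 + s *\<^sub>R axis i 1 = p s t" for s t
    by (simp add: p_def)
  have p1: "((\<lambda>s. g (p s t)) has_vector_derivative partial_deriv i g (p s t)) (at s within S)"
    if "smooth g" for g s t S
    by (rule has_vector_derivative_at_within)
       (rule smooth_line_axis[OF that, of "x + t *\<^sub>R axis j 1" i s, unfolded p_eq])
  have p2: "((\<lambda>t. g (p s t)) has_vector_derivative partial_deriv j g (p s t)) (at t within S)"
    if "smooth g" for g s t S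
    by (rule has_vector_derivative_at_within)
       (rule smooth_line_axis[OF that, of "x + s *\<^sub>R axis i 1" j t, folded p_def])
  have c: "continuous_on S (\<lambda>z. g (p (h z) (k z)))" if "smooth g" "continuous_on S h" "continuous_on S k"
    for g S and h k :: "'z::topological_space \<Rightarrow> real"
    using that(1) unfolding p_def by (rule smooth_continuous_compose) (intro continuous_intros that)
  have ftc: "f (p s t) = f (p 0 t) + integral {0..s} (\<lambda>\<sigma>. partial_deriv i f (p \<sigma> t))" if "0 \<le> s" for s t
  proof -
    have "((\<lambda>\<sigma>. partial_deriv i f (p \<sigma> t)) has_integral f (p s t) - f (p 0 t)) {0..s}"
      using that by (intro fundamental_theorem_of_calculus p1 sm)
    then show ?thesis by (simp add: integral_unique)
  qed
  have eq: "partial_deriv j f (p s 0) =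
      partial_deriv j f (p 0 0) + integral {0..s} (\<lambda>\<sigma>. partial_deriv j (partial_deriv i f) (p \<sigma> 0))"
    if "0 \<le> s" for s
  proof -
    have "((\<lambda>t. integral (cbox 0 s) (\<lambda>\<sigma>. partial_deriv i f (p \<sigma> t))) has_vector_derivative
        integral (cbox 0 s) (\<lambda>\<sigma>. partial_deriv j (partial_deriv i f) (p \<sigma> 0))) (at 0 within UNIV)"
      by (intro leibniz_rule_vector_derivative p2 sm)
         (auto simp: split_beta intro!: integrable_continuous_real c sm continuous_intros)
    then have "((\<lambda>t. f (p s t)) has_vector_derivative partial_deriv j f (p 0 0) +
        integral {0..s} (\<lambda>\<sigma>. partial_deriv j (partial_deriv i f) (p \<sigma> 0))) (at 0)"
      unfolding ftc[OF that] by (intro has_vector_derivative_add p2 sm) simp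
    with p2[OF sm(1), of s 0 UNIV] show ?thesis
      using vector_derivative_unique_at by blast
  qed
  \<comment> \<open>The integral formula holds for nonnegative s only, so the derivative at 0 is
    taken within \<open>{0..1}\<close>; one-sided derivatives there are still unique.\<close>
  have "((\<lambda>s. integral {0..s} (\<lambda>\<sigma>. partial_deriv j (partial_deriv i f) (p \<sigma> 0))) has_vector_derivative
      partial_deriv j (partial_deriv i f) (p 0 0)) (at 0 within {0..1})"
    by (intro integral_has_vector_derivative c sm continuous_intros) auto
  from has_vector_derivative_add[OF has_vector_derivative_const[of "partial_deriv j f (p 0 0)"] this]
  have "((\<lambda>s. partial_deriv j f (p 0 0) + integral {0..s} (\<lambda>\<sigma>. partial_deriv j (partial_deriv i f) (p \<sigma> 0)))
      has_vector_derivative partial_deriv j (partial_deriv i f) (p 0 0)) (at 0 within {0..1})"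
    by (simp only: add_0_left)
  then have "((\<lambda>s. partial_deriv j f (p s 0)) has_vector_derivative
      partial_deriv j (partial_deriv i f) (p 0 0)) (at 0 within {0..1})"
    by (rule has_vector_derivative_transform[rotated 2]) (auto intro: eq)
  moreover have "((\<lambda>s. partial_deriv j f (p s 0)) has_vector_derivative
      partial_deriv i (partial_deriv j f) (p 0 0)) (at 0 within {0..1})"
    by (intro p1 sm)
  ultimately have "partial_deriv i (partial_deriv j f) (p 0 0) = partial_deriv j (partial_deriv i f) (p 0 0)"
    using vector_derivative_unique_within_closed_interval[of 0 1 0] by (simp add: cbox_interval)
  then show "partial_deriv i (partial_deriv j f) x = partial_deriv j (partial_deriv i f) x"
    by (simp add: p_def)
qed

lemma iter_partial_commute:
  fixes f :: "real ^ 'n \<Rightarrow> complex"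
  assumes "smooth f"
  shows "iter_partial xs (partial_deriv i f) = partial_deriv i (iter_partial xs f)"
  by (induction xs) (simp_all add: partial_deriv_commute smooth_iter assms)

lemma iter_partial_mset:
  fixes f :: "real ^ 'n \<Rightarrow> complex"
  assumes "smooth f" "mset xs = mset ys"
  shows "iter_partial xs f = iter_partial ys f"
  using assms(2)
proof (induction xs arbitrary: ys)
  case (Cons a xs)
  then have "a \<in> set ys"
    by (metis list.set_intros(1) set_mset_mset)
  then obtain us vs where ys: "ys = us @ a # vs"
    by (meson split_list)
  with Cons have "iter_partial xs f = iter_partial (us @ vs) f"
    by (intro Cons.IH) simp
  then show ?case
    by (simp add: ys iter_partial_commute smooth_iter assms)
qed simp

section \<open>Translation between multi-indices and lists of coordinates\<close>

lemma multi_deriv_eq_iter: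
  fixes f :: "real ^ 'n \<Rightarrow> complex"
  shows "multi_deriv \<alpha> f = iter_partial (concat (map (\<lambda>i. replicate (\<alpha> i) i) coords)) f"
proof -
  have "foldr (\<lambda>i. partial_deriv i ^^ \<alpha> i) cs f = iter_partial (concat (map (\<lambda>i. replicate (\<alpha> i) i) cs)) f"
    for cs by (induction cs) (simp_all add: foldr_replicate)
  then show ?thesis unfolding multi_deriv_def by blast
qed

lemma coords: "set (coords :: 'n::finite list) = UNIV" "distinct (coords :: 'n list)"
proof -
  have "set (coords :: 'n list) = UNIV \<and> distinct (coords :: 'n list)"
    unfolding coords_def by (rule someI_ex) (simp add: finite_distinct_list)
  then show "set (coords :: 'n::finite list) = UNIV" "distinct (coords :: 'n list)" by auto
qed

lemma length_mindex:
  fixes \<alpha> :: "'n::finite \<Rightarrow> nat"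
  shows "length (concat (map (\<lambda>i. replicate (\<alpha> i) i) coords)) = mindex_abs \<alpha>"
  by (simp add: length_concat comp_def mindex_abs_def sum_list_distinct_conv_sum_set coords)

text \<open>The list and the canonical list of its multiplicities have the same multiset, so
  symmetry of mixed derivatives identifies the two. Lists are preferred in the estimates because
  they allow induction one derivative at a time; this lemma and \<open>length_mindex\<close> carry
  the results back to multi-indices.\<close>

lemma iter_eq_multi_deriv:
  fixes f :: "real ^ 'n \<Rightarrow> complex"
  assumes "smooth f"
  shows "iter_partial xs f = multi_deriv (count_list xs) f"
proof -
  have "count_list (concat (map (\<lambda>i. replicate (\<alpha> i) i) cs)) j = (if j \<in> set cs then \<alpha> j else 0)"
    if "distinct cs" for cs j and \<alpha> :: "'n \<Rightarrow> nat"
  proof -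
    have "count_list (replicate k i) j = (if i = j then k else 0)" for i k
      by (induction k) auto
    then show ?thesis using that by (induction cs) (auto simp: count_list_append)
  qed
  then show ?thesis
    unfolding multi_deriv_eq_iter
    by (intro iter_partial_mset assms) (simp add: multiset_eq_iff count_mset coords)
qed

lemma mindex_abs_count: "mindex_abs (count_list (xs :: 'n::finite list)) = length xs"
  by (simp add: mindex_abs_def sum_count_set)

section \<open>Closure properties of smooth functions and their derivatives\<close>

lemma smooth_const: "smooth (\<lambda>x::real^'n. c)"
proof (rule smooth_coinduct[where P = "\<lambda>f. \<exists>c. f = (\<lambda>x. c)"])
  have "partial_deriv i (\<lambda>x::real^'n. c) = (\<lambda>x. 0)" for i c
    by (rule ext) (subst partial_deriv_eq[OF has_derivative_const], simp)
  then show "\<exists>c. partial_deriv i g = (\<lambda>x. c)" if "\<exists>c. g = (\<lambda>x. c)" for g :: "real^'n \<Rightarrow> complex" and i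
    using that by auto
qed auto

lemma partial_deriv_add:
  fixes f g :: "real ^ 'n \<Rightarrow> complex"
  assumes "\<And>x. f differentiable (at x)" "\<And>x. g differentiable (at x)"
  shows "partial_deriv i (\<lambda>x. f x + g x) = (\<lambda>x. partial_deriv i f x + partial_deriv i g x)"
proof
  fix x
  obtain D E where D: "(f has_derivative D) (at x)" and E: "(g has_derivative E) (at x)"
    using assms by (meson differentiable_def)
  show "partial_deriv i (\<lambda>x. f x + g x) x = partial_deriv i f x + partial_deriv i g x"
    using partial_deriv_eq[OF has_derivative_add[OF D E]] partial_deriv_eq[OF D] partial_deriv_eq[OF E]
    by simp
qed

lemma partial_deriv_mult:
  fixes f g :: "real ^ 'n \<Rightarrow> complex"
  assumes "\<And>x. f differentiable (at x)" "\<And>x. g differentiable (at x)"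
  shows "partial_deriv i (\<lambda>x. f x * g x) = (\<lambda>x. partial_deriv i f x * g x + f x * partial_deriv i g x)"
proof
  fix x
  obtain D E where D: "(f has_derivative D) (at x)" and E: "(g has_derivative E) (at x)"
    using assms by (meson differentiable_def)
  show "partial_deriv i (\<lambda>x. f x * g x) x = partial_deriv i f x * g x + f x * partial_deriv i g x"
    using partial_deriv_eq[OF has_derivative_mult[OF D E]] partial_deriv_eq[OF D] partial_deriv_eq[OF E]
    by simp
qed

text \<open>By the product rule the derivative of a product is a sum of two products, so products
  alone are not stable under partial derivatives. Adding finite sums makes the class stable, and
  thus an invariant for \<open>smooth_coinduct\<close>.\<close>

inductive sum_of_products :: "(real ^ 'n \<Rightarrow> complex) \<Rightarrow> bool" where
  prod: "smooth f \<Longrightarrow> smooth g \<Longrightarrow> sum_of_products (\<lambda>x. f x * g x)"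
| add: "sum_of_products f \<Longrightarrow> sum_of_products g \<Longrightarrow> sum_of_products (\<lambda>x. f x + g x)"

lemma sum_of_products_smooth:
  assumes "sum_of_products f"
  shows "smooth f"
proof (rule smooth_coinduct[where P = sum_of_products, OF assms])
  show d: "g differentiable (at x)" if "sum_of_products g" for g :: "real ^ 'a \<Rightarrow> complex" and x
    using that by induction (auto intro: smooth_differentiable differentiable_mult)
  show "sum_of_products (partial_deriv i g)" if "sum_of_products g" for g :: "real ^ 'a \<Rightarrow> complex" and i
    using that
  proof induction
    case (prod f g)
    then show ?case
      by (auto simp: partial_deriv_mult smooth_differentiable smooth_partial intro!: sum_of_products.intros)
  next
    case (add f g)
    then show ?case
      by (auto simp: partial_deriv_add d intro!: sum_of_products.intros)
  qed
qed

lemma smooth_mult: "smooth f \<Longrightarrow> smooth g \<Longrightarrow> smooth (\<lambda>x. f x * g x)"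
  by (rule sum_of_products_smooth[OF sum_of_products.prod])

lemma smooth_cmult: "smooth f \<Longrightarrow> smooth (\<lambda>x. c * f x)"
  by (intro smooth_mult smooth_const)

lemma smooth_add:
  assumes "smooth f" "smooth g" shows "smooth (\<lambda>x. f x + g x)"
  \<comment> \<open>The factor 1 presents each summand as a product, so sums of smooth functions
    fall under the same class.\<close>
  using sum_of_products.add[OF sum_of_products.prod[OF smooth_const[of 1] assms(1)]
      sum_of_products.prod[OF smooth_const[of 1] assms(2)]]
  by (auto intro: sum_of_products_smooth)

lemma smooth_sum: "(\<And>k. k \<in> K \<Longrightarrow> smooth (f k)) \<Longrightarrow> smooth (\<lambda>x. \<Sum>k\<in>K. f k x)"
  by (induction K rule: infinite_finite_induct) (auto intro: smooth_const smooth_add)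

lemma partial_deriv_cmult:
  fixes f :: "real ^ 'n \<Rightarrow> complex"
  assumes "smooth f"
  shows "partial_deriv i (\<lambda>x. c * f x) = (\<lambda>x. c * partial_deriv i f x)"
proof
  fix x
  show "partial_deriv i (\<lambda>x. c * f x) x = c * partial_deriv i f x"
    unfolding partial_deriv_eq[OF has_derivative_mult_right[OF smooth_has_derivative[OF assms]]]
    by (subst (2) partial_deriv_eq[OF smooth_has_derivative[OF assms]]) (rule refl)
qed

lemma iter_partial_add:
  assumes "smooth f" "smooth g"
  shows "iter_partial xs (\<lambda>x. f x + g x) = (\<lambda>x. iter_partial xs f x + iter_partial xs g x)"
  by (induction xs) (simp_all add: partial_deriv_add smooth_iter smooth_differentiable assms)

lemma iter_partial_cmult:
  assumes "smooth f"
  shows "iter_partial xs (\<lambda>x. c * f x) = (\<lambda>x. c * iter_partial xs f x)"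
  by (induction xs) (simp_all add: partial_deriv_cmult smooth_iter assms)

lemma iter_partial_const_0: "iter_partial xs (\<lambda>x::real^'n. 0) = (\<lambda>x. 0)"
  using iter_partial_cmult[OF smooth_const[of 0], of xs 0] by simp

lemma iter_partial_sum:
  assumes "\<And>k. k \<in> K \<Longrightarrow> smooth (f k)"
  shows "iter_partial xs (\<lambda>x. \<Sum>k\<in>K. f k x) = (\<lambda>x. \<Sum>k\<in>K. iter_partial xs (f k) x)"
  using assms
  by (induction K rule: infinite_finite_induct)
     (simp_all add: iter_partial_const_0 iter_partial_add smooth_sum)

text \<open>Each application of the product rule doubles the number of terms, which gives the power
  of 2. The induction removes the innermost derivative, so that the hypothesis is applied to a new
  pair of functions at the same point with the same \<open>A\<close> and \<open>B\<close>.\<close>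

lemma norm_iter_partial_mult_le:
  fixes f g :: "real ^ 'n \<Rightarrow> complex"
  assumes "smooth f" "smooth g"
    and "\<And>ys. length ys \<le> length xs \<Longrightarrow> norm (iter_partial ys f y) \<le> A"
    and "\<And>ys. length ys \<le> length xs \<Longrightarrow> norm (iter_partial ys g y) \<le> B"
  shows "norm (iter_partial xs (\<lambda>x. f x * g x) y) \<le> 2 ^ length xs * (A * B)"
  using assms
proof (induction xs arbitrary: f g rule: rev_induct)
  case Nil
  then show ?case
    using Nil(3)[of "[]"] Nil(4)[of "[]"] by (auto simp: norm_mult intro!: mult_mono order_trans[OF norm_ge_zero])
next
  case (snoc i xs)
  note sm = snoc.prems(1,2) smooth_partial[OF snoc.prems(1)] smooth_partial[OF snoc.prems(2)]
  have *: "iter_partial (xs @ [i]) (\<lambda>x. f x * g x) y =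
      iter_partial xs (\<lambda>x. partial_deriv i f x * g x) y + iter_partial xs (\<lambda>x. f x * partial_deriv i g x) y"
    using sm by (simp add: partial_deriv_mult smooth_differentiable iter_partial_add smooth_mult)
  have "norm (iter_partial xs (\<lambda>x. partial_deriv i f x * g x) y) \<le> 2 ^ length xs * (A * B)"
  proof (rule snoc.IH)
    show "norm (iter_partial ys (partial_deriv i f) y) \<le> A" if "length ys \<le> length xs" for ys
      using snoc.prems(3)[of "ys @ [i]"] that by simp
  qed (use sm snoc.prems(4) in auto)
  moreover have "norm (iter_partial xs (\<lambda>x. f x * partial_deriv i g x) y) \<le> 2 ^ length xs * (A * B)"
  proof (rule snoc.IH)
    show "norm (iter_partial ys (partial_deriv i g) y) \<le> B" if "length ys \<le> length xs" for ys
      using snoc.prems(4)[of "ys @ [i]"] that by simp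
  qed (use sm snoc.prems(3) in auto)
  ultimately show ?case
    unfolding * by (intro norm_triangle_le) simp
qed

lemma iter_partial_affine:
  fixes f :: "real ^ 'n \<Rightarrow> complex"
  assumes "smooth f"
  shows "smooth (\<lambda>y. f (c *\<^sub>R (y - a)))"
    and "iter_partial xs (\<lambda>y. f (c *\<^sub>R (y - a))) = (\<lambda>y. c ^ length xs *\<^sub>R iter_partial xs f (c *\<^sub>R (y - a)))"
proof -
  have der: "((\<lambda>y. k *\<^sub>R g (c *\<^sub>R (y - a))) has_derivative
      (\<lambda>h. k *\<^sub>R (\<Sum>i\<in>UNIV. (c *\<^sub>R h) $ i *\<^sub>R partial_deriv i g (c *\<^sub>R (y - a))))) (at y)"
    if "smooth g" for g k y
    by (rule has_derivative_scaleR_right, rule has_derivative_compose[OF _ smooth_has_derivative[OF that]])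
       (auto intro!: derivative_eq_intros)
  \<comment> \<open>The scalar \<open>k\<close> stands for the power of \<open>c\<close> collected
    by the derivatives already taken, so that the induction over \<open>xs\<close> closes.\<close>
  have pd: "partial_deriv i (\<lambda>y. k *\<^sub>R g (c *\<^sub>R (y - a))) = (\<lambda>y. (c * k) *\<^sub>R partial_deriv i g (c *\<^sub>R (y - a)))"
    if "smooth g" for g k i
  proof
    fix y
    have "(\<Sum>j\<in>UNIV. (c *\<^sub>R axis i 1) $ j *\<^sub>R partial_deriv j g (c *\<^sub>R (y - a))) =
        (\<Sum>j\<in>UNIV. if j = i then c *\<^sub>R partial_deriv i g (c *\<^sub>R (y - a)) else 0)"
      by (intro sum.cong) (auto simp: axis_def)
    then show "partial_deriv i (\<lambda>y. k *\<^sub>R g (c *\<^sub>R (y - a))) y = (c * k) *\<^sub>R partial_deriv i g (c *\<^sub>R (y - a))"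
      by (simp add: partial_deriv_eq[OF der[OF that]])
  qed
  show eq: "iter_partial xs (\<lambda>y. f (c *\<^sub>R (y - a))) = (\<lambda>y. c ^ length xs *\<^sub>R iter_partial xs f (c *\<^sub>R (y - a)))" for xs
    by (induction xs) (simp_all add: pd smooth_iter assms)
  show "smooth (\<lambda>y. f (c *\<^sub>R (y - a)))"
    unfolding smooth_def eq differentiable_on_def
    using der[OF smooth_iter[OF assms]] by (meson differentiable_at_withinI differentiable_def)
qed

section \<open>Integration of rapidly decreasing functions\<close>

lemma integrable_inverse_1_plus_power2: "integrable lborel (\<lambda>x::real. inverse (1 + x\<^sup>2))"
  using integrable_inverse_1_plus_square by (simp add: set_integrable_def einterval_def)

text \<open>An integrable majorant in product form: its integral factors into one-dimensional
  integrals of 1 / (1 + t^2), and it dominates (1 + |y|)^(-2n) with one factor (1 + |y|)^(-2) per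
  coordinate. This is the origin of the weight exponent \<open>2 * CARD('n)\<close> in the integral
  estimates.\<close>

definition decay :: "real ^ 'n \<Rightarrow> real" where
  "decay y = (\<Prod>b\<in>Basis. inverse (1 + (y \<bullet> b)\<^sup>2))"

lemma decay_ge: "inverse ((1 + norm (y::real^'n)) ^ (2 * CARD('n))) \<le> decay y"
proof -
  have "inverse ((1 + norm y)\<^sup>2) \<le> inverse (1 + (y \<bullet> b)\<^sup>2)" if "b \<in> Basis" for b
  proof (rule le_imp_inverse_le)
    have "(y \<bullet> b)\<^sup>2 \<le> (norm y)\<^sup>2"
      using Basis_le_norm[OF that, of y] by (simp add: abs_le_square_iff[symmetric])
    moreover have "(1 + norm y)\<^sup>2 = 1 + (norm y)\<^sup>2 + 2 * norm y"
      by (simp add: power2_sum)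
    moreover have "0 \<le> norm y" by simp
    ultimately show "1 + (y \<bullet> b)\<^sup>2 \<le> (1 + norm y)\<^sup>2"
      by linarith
  qed (simp add: add_pos_nonneg)
  then have "(\<Prod>b\<in>(Basis::(real^'n) set). inverse ((1 + norm y)\<^sup>2)) \<le> decay y"
    unfolding decay_def by (intro prod_mono) simp
  then show ?thesis
    by (simp add: power_mult power_inverse)
qed

lemma decay_integrable: "integrable lborel (decay :: real ^ 'n \<Rightarrow> real)"
proof (rule integrableI_nonneg)
  show "decay \<in> borel_measurable lborel" unfolding decay_def[abs_def] by measurable
  show "AE x in lborel. 0 \<le> decay (x::real^'n)"
    by (simp add: decay_def prod_nonneg)
  have "(\<integral>\<^sup>+x. ennreal (decay (x::real^'n)) \<partial>lborel) =
      (\<integral>\<^sup>+x. (\<Prod>b\<in>Basis. ennreal (inverse (1 + ((x::real^'n) \<bullet> b)\<^sup>2))) \<partial>lborel)"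
    by (simp add: decay_def prod_ennreal)
  also have "\<dots> = (\<Prod>b\<in>(Basis::(real^'n) set). (\<integral>\<^sup>+x. ennreal (inverse (1 + x\<^sup>2)) \<partial>lborel))"
    by (rule nn_integral_lborel_prod) auto
  also have "\<dots> < \<infinity>"
    using integrable_inverse_1_plus_power2
    by (simp add: integrable_iff_bounded power_less_top_ennreal)
  finally show "(\<integral>\<^sup>+x. ennreal (decay (x::real^'n)) \<partial>lborel) < \<infinity>" .
qed

lemma
  fixes f :: "real ^ 'n \<Rightarrow> complex"
  assumes "continuous_on UNIV f"
    and bd: "\<And>y. (1 + norm y) ^ (2 * CARD('n)) * norm (f y) \<le> C"
  shows rapidly_decreasing_integrable: "integrable lborel f"
    and norm_integral_le_decay: "norm (LINT y|lborel. f y) \<le> C * (LINT y|lborel. decay (y::real^'n))"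
proof -
  have "0 \<le> C"
    using bd[of 0] by (meson norm_ge_zero order_trans zero_le_mult_iff zero_le_power add_nonneg_nonneg zero_le_one)
  have le: "norm (f y) \<le> C * decay y" for y
  proof -
    have pos: "0 < (1 + norm y) ^ (2 * CARD('n))" by (simp add: add_pos_nonneg)
    have "norm (f y) \<le> C * inverse ((1 + norm y) ^ (2 * CARD('n)))"
      using bd[of y] pos by (simp add: divide_simps mult.commute)
    also have "\<dots> \<le> C * decay y"
      by (rule mult_left_mono[OF decay_ge \<open>0 \<le> C\<close>])
    finally show ?thesis .
  qed
  have int: "integrable lborel (\<lambda>y::real^'n. C * decay y)"
    by (rule integrable_mult_right) (simp add: decay_integrable)
  have meas: "f \<in> borel_measurable lborel"
    using assms(1) by (simp add: borel_measurable_continuous_onI)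
  show *: "integrable lborel f"
    by (rule Bochner_Integration.integrable_bound[OF int meas])
       (auto intro!: AE_I2 order_trans[OF le])
  show "norm (LINT y|lborel. f y) \<le> C * (LINT y|lborel. decay (y::real^'n))"
    using Bochner_Integration.integral_norm_bound_integral[OF * int le] by simp
qed

lemma lborel_integral_affine:
  fixes g :: "real ^ 'n \<Rightarrow> complex"
  assumes [measurable]: "g \<in> borel_measurable borel" and "c \<noteq> 0"
  shows "(LINT y|lborel. g y) = \<bar>c\<bar> ^ CARD('n) *\<^sub>R (LINT z|lborel. g (t + c *\<^sub>R z))"
proof -
  have "(LINT y|lborel. g y) =
      (LINT y|density (distr lborel borel (\<lambda>x. t + c *\<^sub>R x)) (\<lambda>_. ennreal (\<bar>c\<bar> ^ CARD('n))). g y)"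
    using lborel_affine[OF \<open>c \<noteq> 0\<close>, of t] by simp
  also have "\<dots> = (LINT y|distr lborel borel (\<lambda>x. t + c *\<^sub>R x). \<bar>c\<bar> ^ CARD('n) *\<^sub>R g y)"
    by (rule integral_density) auto
  also have "\<dots> = (LINT z|lborel. \<bar>c\<bar> ^ CARD('n) *\<^sub>R g (t + c *\<^sub>R z))"
    by (rule integral_distr) auto
  finally show ?thesis by simp
qed

section \<open>Finite differences\<close>

definition fdiff :: "real \<Rightarrow> (real \<Rightarrow> 'a) \<Rightarrow> real \<Rightarrow> 'a::real_normed_vector" where
  "fdiff h g t = g (t + h) - g t"

lemma fdiff_Suc: "(fdiff h ^^ Suc p) g t = (fdiff h ^^ p) g (t + h) - (fdiff h ^^ p) g t"
  by (simp add: fdiff_def[of h "(fdiff h ^^ p) g"])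

text \<open>Induction by Pascal's rule on the binomial coefficients; the alternating sign turns the
  difference of the two sums into the Pascal sum.\<close>

lemma fdiff_funpow:
  fixes g :: "real \<Rightarrow> complex"
  shows "(fdiff h ^^ M) g t = (\<Sum>k\<le>M. (- 1) ^ (M + k) * of_nat (M choose k) * g (t + real k * h))"
proof (induction M arbitrary: t)
  case (Suc M)
  define a where "a k = g (t + real k * h)" for k
  define c where "c M k = (- 1) ^ (M + k) * (of_nat (M choose k) :: complex)" for M k
  have "(fdiff h ^^ Suc M) g t = (\<Sum>k\<le>M. c M k * a (Suc k)) - (\<Sum>k\<le>M. c M k * a k)"
    unfolding fdiff_Suc Suc by (simp add: a_def c_def algebra_simps)
  \<comment> \<open>The added term vanishes since \<open>M choose Suc M\<close> is 0; afterwards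
    splitting off index 0 aligns this sum with the shifted one.\<close>
  also have "(\<Sum>k\<le>M. c M k * a k) = (\<Sum>k\<le>Suc M. c M k * a k)"
    by (simp add: c_def)
  also have "\<dots> = c M 0 * a 0 + (\<Sum>k\<le>M. c M (Suc k) * a (Suc k))"
    by (rule sum.atMost_Suc_shift)
  also have "(\<Sum>k\<le>M. c M k * a (Suc k)) - \<dots> = c (Suc M) 0 * a 0 + (\<Sum>k\<le>M. c (Suc M) (Suc k) * a (Suc k))"
    by (simp add: c_def sum_subtractf[symmetric] algebra_simps)
  also have "\<dots> = (\<Sum>k\<le>Suc M. c (Suc M) k * a k)"
    by (rule sum.atMost_Suc_shift[symmetric])
  finally show ?case by (simp only: a_def c_def)
qed simp

text \<open>A single difference at most doubles a bound. The condition on \<open>T\<close> ensures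
  that all p further steps of length h stay in the interval where \<open>B\<close> is valid.\<close>

lemma norm_fdiff_funpow_le:
  assumes "\<And>t. 0 \<le> t \<Longrightarrow> t \<le> T \<Longrightarrow> norm (g t) \<le> B" "0 \<le> h" "0 \<le> t" "t + real p * h \<le> T"
  shows "norm ((fdiff h ^^ p) g t) \<le> 2 ^ p * B"
  using assms(3,4)
proof (induction p arbitrary: t)
  case (Suc p)
  have "norm ((fdiff h ^^ p) g (t + h)) \<le> 2 ^ p * B"
    using Suc.prems assms(2) by (intro Suc.IH) (auto simp: algebra_simps)
  moreover have "norm ((fdiff h ^^ p) g t) \<le> 2 ^ p * B"
    using Suc.prems assms(2) by (intro Suc.IH) (auto simp: algebra_simps)
  ultimately show ?case
    unfolding fdiff_Suc by (intro norm_triangle_le_diff) simp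
qed (use assms in auto)

lemma has_vector_derivative_shift:
  fixes f :: "real \<Rightarrow> complex"
  assumes "(f has_vector_derivative d) (at (s + h))"
  shows "((\<lambda>s. f (s + h)) has_vector_derivative d) (at s)"
proof -
  have "((\<lambda>s. s + h) has_vector_derivative 1) (at s)"
    by (auto intro!: derivative_eq_intros)
  from vector_diff_chain_at[OF this assms] show ?thesis by (simp add: o_def)
qed

text \<open>By the mean value inequality one difference trades a derivative for a factor h.
  \<open>G\<close> lists a function with its successive derivatives; the induction passes to the
  differenced family \<open>fdiff h (G k)\<close>, which is again such a list, on an interval
  shorter by h.\<close>

lemma norm_fdiff_funpow_le_deriv:
  fixes G :: "nat \<Rightarrow> real \<Rightarrow> complex"
  assumes "\<And>k t. (G k has_vector_derivative G (Suc k) t) (at t)"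
    and "\<And>t. 0 \<le> t \<Longrightarrow> t \<le> T \<Longrightarrow> norm (G q t) \<le> B" "0 \<le> h" "0 \<le> t" "t + real q * h \<le> T"
  shows "norm ((fdiff h ^^ q) (G 0) t) \<le> h ^ q * B"
  using assms
proof (induction q arbitrary: G B T)
  case (Suc q)
  have "norm ((fdiff h ^^ q) ((\<lambda>k. fdiff h (G k)) 0) t) \<le> h ^ q * (B * h)"
  proof (rule Suc.IH[where T = "T - h"])
    show "(fdiff h (G k) has_vector_derivative fdiff h (G (Suc k)) s) (at s)" for k s
    proof -
      have "((\<lambda>s. G k (s + h)) has_vector_derivative G (Suc k) (s + h)) (at s)"
        using Suc.prems(1)[of k "s + h"] by (rule has_vector_derivative_shift)
      then show ?thesis
        unfolding fdiff_def[abs_def] by (intro has_vector_derivative_diff Suc.prems(1))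
    qed
    show "norm (fdiff h (G q) s) \<le> B * h" if "0 \<le> s" "s \<le> T - h" for s
    proof -
      have "norm (G q (s + h) - G q s) \<le> B * norm (s + h - s)"
      proof (rule differentiable_bound[of "{s..s+h}" "G q" "\<lambda>x r. r *\<^sub>R G (Suc q) x"])
        show "(G q has_derivative (\<lambda>r. r *\<^sub>R G (Suc q) x)) (at x within {s..s + h})" for x
          using Suc.prems(1)[of q x] by (simp add: has_vector_derivative_def has_derivative_at_withinI)
        show "onorm (\<lambda>r. r *\<^sub>R G (Suc q) x) \<le> B" if "x \<in> {s..s + h}" for x
        proof (rule onorm_le)
          fix r :: real
          have "norm (G (Suc q) x) \<le> B"
            using that \<open>0 \<le> s\<close> \<open>s \<le> T - h\<close> by (intro Suc.prems(2)) auto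
          then show "norm (r *\<^sub>R G (Suc q) x) \<le> B * norm r"
            by (simp add: mult.commute[of B] mult_left_mono)
        qed
      qed (use Suc.prems in auto)
      then show ?thesis using \<open>0 \<le> h\<close> by (simp add: fdiff_def)
    qed
    show "t + real q * h \<le> T - h" using Suc.prems by (simp add: algebra_simps)
  qed (use Suc.prems in auto)
  then show ?case
    by (simp add: funpow_swap1 algebra_simps)
qed auto

text \<open>Of the M differences, q are spent on derivatives and yield h^q, while the remaining M -
  q are estimated trivially by a factor 2 each. The same difference thus satisfies the bound for
  every q up to M, which is what allows q to be chosen long after M.\<close>

lemma norm_fdiff_mixed_le:
  fixes G :: "nat \<Rightarrow> real \<Rightarrow> complex"
  assumes "\<And>k t. (G k has_vector_derivative G (Suc k) t) (at t)"
    and "\<And>t. 0 \<le> t \<Longrightarrow> t \<le> 1 \<Longrightarrow> norm (G q t) \<le> B"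
    and "0 \<le> h" "real M * h \<le> 1" "q \<le> M" "0 \<le> B"
  shows "norm ((fdiff h ^^ M) (G 0) 0) \<le> 2 ^ M * h ^ q * B"
proof -
  have "norm ((fdiff h ^^ (M - q)) ((fdiff h ^^ q) (G 0)) 0) \<le> 2 ^ (M - q) * (h ^ q * B)"
  proof (rule norm_fdiff_funpow_le[where T = "1 - real q * h"])
    show "norm ((fdiff h ^^ q) (G 0) t) \<le> h ^ q * B" if "0 \<le> t" "t \<le> 1 - real q * h" for t
      using that assms(3) by (intro norm_fdiff_funpow_le_deriv[where T = 1] assms(1,2)) auto
    show "0 + real (M - q) * h \<le> 1 - real q * h"
      using assms by (simp add: of_nat_diff algebra_simps)
  qed (use assms in auto)
  also have "(fdiff h ^^ (M - q)) ((fdiff h ^^ q) (G 0)) = (fdiff h ^^ M) (G 0)"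
    using fun_cong[OF funpow_add[of "M - q" q "fdiff h"], of "G 0"] \<open>q \<le> M\<close> by simp
  \<comment> \<open>Rounding up to 2^M makes the loss independent of q.\<close>
  also have "2 ^ (M - q) * (h ^ q * B) \<le> 2 ^ M * (h ^ q * B)"
    using assms by (intro mult_right_mono power_increasing) auto
  finally show ?thesis by (simp add: mult.assoc)
qed

section \<open>Directional derivatives\<close>

definition dir_deriv :: "real ^ 'n \<Rightarrow> (real ^ 'n \<Rightarrow> complex) \<Rightarrow> real ^ 'n \<Rightarrow> complex" where
  "dir_deriv z f = (\<lambda>x. \<Sum>i\<in>UNIV. of_real (z $ i) * partial_deriv i f x)"

lemma smooth_dir_deriv: "smooth f \<Longrightarrow> smooth (dir_deriv z f)"
  unfolding dir_deriv_def by (intro smooth_sum smooth_cmult smooth_partial)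

lemma smooth_dir_deriv_funpow: "smooth f \<Longrightarrow> smooth ((dir_deriv z ^^ k) f)"
  by (induction k) (auto intro: smooth_dir_deriv)

lemma has_vector_derivative_dir_deriv:
  "smooth f \<Longrightarrow> ((\<lambda>t. f (x + t *\<^sub>R z)) has_vector_derivative dir_deriv z f (x + t *\<^sub>R z)) (at t)"
  using smooth_line[of f x z t] by (simp add: dir_deriv_def scaleR_conv_of_real)

text \<open>Expanding the k-th directional derivative gives n^k terms, each with a coefficient of
  modulus at most |z|^k. The polynomial factor in |z| is absorbed later by the decay of
  \<rho>.\<close>

lemma norm_dir_deriv_funpow_le:
  fixes f :: "real ^ 'n \<Rightarrow> complex"
  assumes "smooth f" "\<And>xs. length xs = k \<Longrightarrow> norm (iter_partial xs f y) \<le> B"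
  shows "norm ((dir_deriv z ^^ k) f y) \<le> (real CARD('n) * norm z) ^ k * B"
  using assms
proof (induction k arbitrary: f B)
  case (Suc k)
  have "norm ((dir_deriv z ^^ k) (dir_deriv z f) y) \<le>
      (real CARD('n) * norm z) ^ k * (real CARD('n) * (norm z * B))"
  proof (rule Suc.IH)
    show "smooth (dir_deriv z f)" by (intro smooth_dir_deriv Suc.prems)
    show "norm (iter_partial xs (dir_deriv z f) y) \<le> real CARD('n) * (norm z * B)" if "length xs = k" for xs
    proof -
      have "iter_partial xs (dir_deriv z f) y = (\<Sum>i\<in>UNIV. of_real (z $ i) * iter_partial xs (partial_deriv i f) y)"
        using Suc.prems(1)
        by (simp add: dir_deriv_def iter_partial_sum iter_partial_cmult smooth_cmult smooth_partial)
      also have "norm \<dots> \<le> (\<Sum>i\<in>(UNIV::'n set). norm z * B)"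
      proof (rule sum_norm_le)
        fix i
        have "norm (iter_partial (xs @ [i]) f y) \<le> B"
          using that by (intro Suc.prems) simp
        then show "norm (of_real (z $ i) * iter_partial xs (partial_deriv i f) y) \<le> norm z * B"
          by (auto simp: norm_mult component_le_norm_cart intro!: mult_mono)
      qed
      finally show ?thesis by simp
    qed
  qed
  then show ?case by (simp add: funpow_swap1 mult_ac)
qed (use assms in force)

section \<open>Pointwise form of the seminorms\<close>

definition schwartz_bound :: "nat \<Rightarrow> real \<Rightarrow> (real ^ 'n \<Rightarrow> complex) \<Rightarrow> bool" where
  "schwartz_bound j C f \<longleftrightarrow>
     (\<forall>xs y. length xs \<le> j \<longrightarrow> (1 + norm y) ^ j * norm (iter_partial xs f y) \<le> C)"

text \<open>One exponent \<open>N\<close> and one constant \<open>C\<close> serve all derivatives up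
  to order \<open>j\<close>. This is the form in which a product with a Schwartz function can be
  estimated at once.\<close>

definition growth_bound :: "nat \<Rightarrow> nat \<Rightarrow> real \<Rightarrow> (real ^ 'n \<Rightarrow> complex) \<Rightarrow> bool" where
  "growth_bound N j C f \<longleftrightarrow>
     (\<forall>xs y. length xs \<le> j \<longrightarrow> norm (iter_partial xs f y) \<le> C * (1 + norm y) ^ N)"

lemma schwartz_seminorm_le_iff:
  fixes f :: "real ^ 'n \<Rightarrow> complex"
  assumes "smooth f" "0 \<le> C"
  shows "schwartz_seminorm j f \<le> ennreal C \<longleftrightarrow> schwartz_bound j C f"
proof -
  have "schwartz_seminorm j f \<le> ennreal C \<longleftrightarrow>
      (\<forall>\<alpha> y. mindex_abs \<alpha> \<le> j \<longrightarrow> (1 + norm y) ^ j * norm (multi_deriv \<alpha> f y) \<le> C)"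
    unfolding schwartz_seminorm_def by (auto simp: SUP_le_iff ennreal_le_iff assms)
  also have "\<dots> \<longleftrightarrow> schwartz_bound j C f"
    unfolding schwartz_bound_def
  proof (intro iffI allI impI)
    fix xs :: "'n list" and y
    assume "\<forall>\<alpha> y. mindex_abs \<alpha> \<le> j \<longrightarrow> (1 + norm y) ^ j * norm (multi_deriv \<alpha> f y) \<le> C" "length xs \<le> j"
    then show "(1 + norm y) ^ j * norm (iter_partial xs f y) \<le> C"
      by (simp add: iter_eq_multi_deriv[OF assms(1)] mindex_abs_count)
  next
    fix \<alpha> :: "'n \<Rightarrow> nat" and y
    assume "\<forall>xs y. length xs \<le> j \<longrightarrow> (1 + norm y) ^ j * norm (iter_partial xs f y) \<le> C" "mindex_abs \<alpha> \<le> j"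
    then show "(1 + norm y) ^ j * norm (multi_deriv \<alpha> f y) \<le> C"
      unfolding multi_deriv_eq_iter using length_mindex[of \<alpha>] by auto
  qed
  finally show ?thesis .
qed

lemma tempered_seminorm_le_iff:
  assumes "0 \<le> C"
  shows "tempered_seminorm N \<alpha> f \<le> ennreal C \<longleftrightarrow> (\<forall>y. norm (multi_deriv \<alpha> f y) \<le> C * (1 + norm y) ^ N)"
proof -
  have "(1 + norm y) powi (- int N) * a \<le> C \<longleftrightarrow> a \<le> C * (1 + norm y) ^ N" for y :: "real^'a" and a
  proof -
    have "0 < (1 + norm y) ^ N" by (simp add: add_pos_nonneg)
    then show ?thesis
      by (simp add: power_int_minus divide_simps mult.commute)
  qed
  then show ?thesis
    unfolding tempered_seminorm_def by (simp add: SUP_le_iff ennreal_le_iff assms)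
qed

section \<open>Order estimates as eventual inequalities with explicit constants\<close>

lemma eventually_unit_interval: "\<forall>\<^sub>F \<epsilon> in at_right (0::real). 0 < \<epsilon> \<and> \<epsilon> \<le> 1"
  by (auto simp: eventually_at_right_field intro: exI[of _ 1])

lemma bigO_real_iff:
  fixes f :: "real \<Rightarrow> real"
  assumes "\<And>\<epsilon>. 0 \<le> f \<epsilon>"
  shows "f \<in> O[at_right 0](\<lambda>\<epsilon>. \<epsilon> powi k) \<longleftrightarrow> (\<exists>C\<ge>0. \<forall>\<^sub>F \<epsilon> in at_right 0. f \<epsilon> \<le> C * \<epsilon> powi k)"
proof
  assume "f \<in> O[at_right 0](\<lambda>\<epsilon>. \<epsilon> powi k)"
  then obtain C where "C > 0" "\<forall>\<^sub>F \<epsilon> in at_right 0. norm (f \<epsilon>) \<le> C * norm (\<epsilon> powi k)"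
    by (auto elim: landau_o.bigE)
  then show "\<exists>C\<ge>0. \<forall>\<^sub>F \<epsilon> in at_right 0. f \<epsilon> \<le> C * \<epsilon> powi k"
    using eventually_unit_interval
    by (intro exI[of _ C] conjI) (auto elim: eventually_elim2 simp: assms power_int_abs)
next
  assume "\<exists>C\<ge>0. \<forall>\<^sub>F \<epsilon> in at_right 0. f \<epsilon> \<le> C * \<epsilon> powi k"
  then obtain C where "\<forall>\<^sub>F \<epsilon> in at_right 0. f \<epsilon> \<le> C * \<epsilon> powi k" by blast
  then show "f \<in> O[at_right 0](\<lambda>\<epsilon>. \<epsilon> powi k)"
    using eventually_unit_interval
    by (intro bigoI[of _ C]) (auto elim: eventually_elim2 simp: assms power_int_abs)
qed

text \<open>A value below \<open>ennreal\<close> of a real number is finite, so the finiteness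
  clause and the real estimate merge into a single inequality in \<open>ennreal\<close>.\<close>

lemma bigO_net_iff:
  "bigO_net p k \<longleftrightarrow> (\<exists>C\<ge>0. \<forall>\<^sub>F \<epsilon> in at_right 0. p \<epsilon> \<le> ennreal (C * \<epsilon> powi k))"
proof -
  have eq: "p \<epsilon> < \<infinity> \<and> enn2real (p \<epsilon>) \<le> C * \<epsilon> powi k \<longleftrightarrow> p \<epsilon> \<le> ennreal (C * \<epsilon> powi k)"
    if "0 \<le> C" "0 < \<epsilon> \<and> \<epsilon> \<le> 1" for C \<epsilon>
  proof -
    have "0 \<le> C * \<epsilon> powi k" using that by simp
    then show ?thesis
      by (cases "p \<epsilon>") (auto simp: ennreal_le_iff top_unique)
  qed
  have "bigO_net p k \<longleftrightarrow> (\<exists>C\<ge>0. \<forall>\<^sub>F \<epsilon> in at_right 0. p \<epsilon> < \<infinity> \<and> enn2real (p \<epsilon>) \<le> C * \<epsilon> powi k)"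
    unfolding bigO_net_def by (subst bigO_real_iff) (auto simp: eventually_conj_iff)
  also have "\<dots> \<longleftrightarrow> (\<exists>C\<ge>0. \<forall>\<^sub>F \<epsilon> in at_right 0. p \<epsilon> \<le> ennreal (C * \<epsilon> powi k))"
    by (intro ex_cong1 conj_cong refl eventually_subst eventually_mono[OF eventually_unit_interval]) (rule eq)
  finally show ?thesis .
qed

lemma moderate_nets_iff:
  "x \<in> moderate_nets \<longleftrightarrow> (\<exists>N C. 0 \<le> C \<and> (\<forall>\<^sub>F \<epsilon> in at_right 0. norm (x \<epsilon>) \<le> C * \<epsilon> powi (- int N)))"
  by (simp add: moderate_nets_def bigO_real_iff)

lemma negligible_nets_iff:
  "x \<in> negligible_nets \<longleftrightarrow> (\<forall>q::nat. \<exists>C\<ge>0. \<forall>\<^sub>F \<epsilon> in at_right 0. norm (x \<epsilon>) \<le> C * \<epsilon> ^ q)"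
  using bigO_real_iff[of "\<lambda>\<epsilon>. norm (x \<epsilon>)" "int _"] by (simp add: negligible_nets_def)

lemma schwartz_space_iff:
  "f \<in> schwartz_space \<longleftrightarrow> smooth f \<and> (\<forall>j. \<exists>C\<ge>0. schwartz_bound j C f)"
proof -
  have "schwartz_seminorm j f < \<infinity> \<longleftrightarrow> (\<exists>C\<ge>0. schwartz_bound j C f)" if "smooth f" for j
  proof
    assume "schwartz_seminorm j f < \<infinity>"
    then show "\<exists>C\<ge>0. schwartz_bound j C f"
      using schwartz_seminorm_le_iff[OF that, of _ j] by (cases "schwartz_seminorm j f") auto
  next
    assume "\<exists>C\<ge>0. schwartz_bound j C f"
    then show "schwartz_seminorm j f < \<infinity>"
      using schwartz_seminorm_le_iff[OF that, of _ j] le_less_trans by fastforce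
  qed
  then show ?thesis by (auto simp: schwartz_space_def)
qed

text \<open>Exponent and constant depend on the derivative, but there are only finitely many lists
  of length at most \<open>j\<close>. The sums over all of them are common upper bounds.\<close>

lemma O_M_growth_bound:
  fixes f :: "real ^ 'n \<Rightarrow> complex"
  assumes "f \<in> O_M"
  obtains N C where "0 \<le> C" "growth_bound N j C f"
proof -
  have sm: "smooth f" using assms by (simp add: O_M_def)
  have "\<exists>N C. 0 \<le> C \<and> (\<forall>y. norm (iter_partial xs f y) \<le> C * (1 + norm y) ^ N)" for xs
  proof -
    obtain N where "tempered_seminorm N (count_list xs) f < \<infinity>"
      using assms by (auto simp: O_M_def)
    then show ?thesis
      using tempered_seminorm_le_iff[of _ N "count_list xs" f]
      by (cases "tempered_seminorm N (count_list xs) f") (auto simp: iter_eq_multi_deriv[OF sm])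
  qed
  then obtain N C where *: "\<And>xs. 0 \<le> C xs" "\<And>xs y. norm (iter_partial xs f y) \<le> C xs * (1 + norm y) ^ N xs"
    by metis
  define L where "L = {xs::'n list. length xs \<le> j}"
  have fin: "finite L"
    unfolding L_def using finite_lists_length_le[of "UNIV::'n set" j] by simp
  have "growth_bound (sum N L) j (sum C L) f"
    unfolding growth_bound_def
  proof (intro allI impI)
    fix xs :: "'n list" and y :: "real ^ 'n" assume "length xs \<le> j"
    then have "C xs \<le> sum C L" "N xs \<le> sum N L"
      using fin * by (auto simp: L_def intro!: member_le_sum)
    then have "C xs * (1 + norm y) ^ N xs \<le> sum C L * (1 + norm y) ^ sum N L"
      using * by (intro mult_mono power_increasing sum_nonneg) auto
    then show "norm (iter_partial xs f y) \<le> sum C L * (1 + norm y) ^ sum N L"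
      using *(2) order_trans by blast
  qed
  moreover have "0 \<le> sum C L" using * by (intro sum_nonneg) auto
  ultimately show ?thesis using that by blast
qed

text \<open>The N surplus powers of the weight on \<open>f\<close> cancel the growth of
  \<open>g\<close>; the factor 2^j counts the terms of the product rule.\<close>

lemma schwartz_bound_mult:
  fixes f g :: "real ^ 'n \<Rightarrow> complex"
  assumes "smooth f" "smooth g" "schwartz_bound (j + N) A f" "growth_bound N j B g" "0 \<le> A" "0 \<le> B"
  shows "schwartz_bound j (2 ^ j * A * B) (\<lambda>x. f x * g x)"
  unfolding schwartz_bound_def
proof (intro allI impI)
  fix xs :: "'n list" and y :: "real ^ 'n" assume len: "length xs \<le> j"
  have pos: "0 < 1 + norm y" by (simp add: add_pos_nonneg)
  have "norm (iter_partial xs (\<lambda>x. f x * g x) y) \<le>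
      2 ^ length xs * (A / (1 + norm y) ^ (j + N) * (B * (1 + norm y) ^ N))"
  proof (rule norm_iter_partial_mult_le[OF assms(1,2)])
    fix ys :: "'n list" assume "length ys \<le> length xs"
    with len have "length ys \<le> j + N" "length ys \<le> j" by auto
    with assms(3,4) have "(1 + norm y) ^ (j + N) * norm (iter_partial ys f y) \<le> A"
      and "norm (iter_partial ys g y) \<le> B * (1 + norm y) ^ N"
      by (auto simp: schwartz_bound_def growth_bound_def)
    then show "norm (iter_partial ys f y) \<le> A / (1 + norm y) ^ (j + N)"
      "norm (iter_partial ys g y) \<le> B * (1 + norm y) ^ N"
      using pos by (auto simp: pos_le_divide_eq mult.commute)
  qed
  also have "\<dots> = 2 ^ length xs * (A * B) / (1 + norm y) ^ j"
    using pos by (simp add: power_add)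
  also have "\<dots> \<le> 2 ^ j * (A * B) / (1 + norm y) ^ j"
    using len assms pos by (intro divide_right_mono mult_right_mono power_increasing) auto
  finally show "(1 + norm y) ^ j * norm (iter_partial xs (\<lambda>x. f x * g x) y) \<le> 2 ^ j * A * B"
    using pos by (simp add: pos_le_divide_eq mult_ac)
qed

lemma schwartz_O_M_mult:
  assumes "f \<in> schwartz_space" "g \<in> O_M"
  shows "(\<lambda>x. f x * g x) \<in> schwartz_space"
proof -
  have sm: "smooth f" "smooth g"
    using assms by (auto simp: schwartz_space_def O_M_def)
  have "\<exists>C\<ge>0. schwartz_bound j C (\<lambda>x. f x * g x)" for j
  proof -
    obtain N B where B: "0 \<le> B" "growth_bound N j B g"
      using O_M_growth_bound[OF assms(2)] by blast
    obtain A where A: "0 \<le> A" "schwartz_bound (j + N) A f"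
      using assms(1) by (auto simp: schwartz_space_iff)
    have "schwartz_bound j (2 ^ j * A * B) (\<lambda>x. f x * g x)"
      by (rule schwartz_bound_mult[OF sm A(2) B(2) A(1) B(1)])
    moreover have "0 \<le> 2 ^ j * A * B" using A(1) B(1) by simp
    ultimately show ?thesis by blast
  qed
  then show ?thesis
    unfolding schwartz_space_iff by (intro conjI allI smooth_mult sm)
qed

lemma schwartz_bound_value:
  "schwartz_bound j C f \<Longrightarrow> (1 + norm y) ^ j * norm (f y) \<le> C"
  unfolding schwartz_bound_def by (metis foldr.simps(1) id_apply le0 list.size(3))

lemma schwartz_bound_0: "schwartz_bound j 0 (\<lambda>x. 0)"
  by (simp add: schwartz_bound_def iter_partial_const_0)

lemma schwartz_integrable:
  fixes f :: "real ^ 'n \<Rightarrow> complex"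
  assumes "f \<in> schwartz_space"
  shows "integrable lborel f"
proof -
  obtain C where "schwartz_bound (2 * CARD('n)) C f" and "smooth f"
    using assms by (auto simp: schwartz_space_iff)
  then show ?thesis
    by (intro rapidly_decreasing_integrable[of _ C] schwartz_bound_value smooth_continuous_on)
qed

section \<open>The Gaussian\<close>

text \<open>The Gaussian together with polynomial factors is stable under partial derivatives, which
  the Gaussian alone is not. Hence smoothness and rapid decay of all derivatives can be proved for
  the whole class at once.\<close>

definition gauss_poly :: "(real ^ 'n \<Rightarrow> real) \<Rightarrow> real ^ 'n \<Rightarrow> complex" where
  "gauss_poly p = (\<lambda>y. of_real (p y * exp (- (y \<bullet> y))))"

lemma real_polynomial_function_has_derivative:
  fixes p :: "'a::real_normed_vector \<Rightarrow> real"
  assumes "real_polynomial_function p"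
  shows "\<exists>D. (\<forall>x. (p has_derivative D x) (at x)) \<and> (\<forall>v. real_polynomial_function (\<lambda>x. D x v))"
  using assms
proof induction
  case (linear f)
  then show ?case
    by (intro exI[of _ "\<lambda>x. f"]) (auto intro: bounded_linear_imp_has_derivative)
next
  case (const c)
  show ?case by (intro exI[of _ "\<lambda>x v. 0"]) auto
next
  case (add f g)
  then obtain D E where "\<And>x. (f has_derivative D x) (at x)" "\<And>v. real_polynomial_function (\<lambda>x. D x v)"
    "\<And>x. (g has_derivative E x) (at x)" "\<And>v. real_polynomial_function (\<lambda>x. E x v)" by metis
  then show ?case
    by (intro exI[of _ "\<lambda>x v. D x v + E x v"]) (auto intro: has_derivative_add)
next
  case (mult f g)
  then obtain D E where "\<And>x. (f has_derivative D x) (at x)" "\<And>v. real_polynomial_function (\<lambda>x. D x v)"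
    "\<And>x. (g has_derivative E x) (at x)" "\<And>v. real_polynomial_function (\<lambda>x. E x v)" by metis
  with mult.hyps show ?case
    by (intro exI[of _ "\<lambda>x v. f x * E x v + D x v * g x"] conjI allI has_derivative_mult
        real_polynomial_function.intros(3,4))
qed

lemma real_polynomial_function_growth:
  fixes p :: "'a::real_normed_vector \<Rightarrow> real"
  assumes "real_polynomial_function p"
  shows "\<exists>C k. 0 \<le> C \<and> (\<forall>x. \<bar>p x\<bar> \<le> C * (1 + norm x) ^ k)"
  using assms
proof induction
  case (linear f)
  then obtain K where K: "\<And>x. norm (f x) \<le> norm x * K" "0 \<le> K"
    using bounded_linear.nonneg_bounded by blast
  have "\<bar>f x\<bar> \<le> K * (1 + norm x) ^ 1" for x
    using K(1)[of x] K(2) by (simp add: algebra_simps)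
  with K(2) show ?case by blast
next
  case (const c)
  show ?case by (intro exI[of _ "\<bar>c\<bar>"] exI[of _ 0]) auto
next
  case (add f g)
  then obtain C k D l where *: "0 \<le> C" "\<And>x. \<bar>f x\<bar> \<le> C * (1 + norm x) ^ k"
    "0 \<le> D" "\<And>x. \<bar>g x\<bar> \<le> D * (1 + norm x) ^ l" by metis
  have "\<bar>f x + g x\<bar> \<le> (C + D) * (1 + norm x) ^ (k + l)" for x
  proof -
    have "C * (1 + norm x) ^ k \<le> C * (1 + norm x) ^ (k + l)" "D * (1 + norm x) ^ l \<le> D * (1 + norm x) ^ (k + l)"
      using * by (auto intro!: mult_left_mono power_increasing)
    then show ?thesis using *(2)[of x] *(4)[of x] by (simp add: distrib_right)
  qed
  with * show ?case by (intro exI[of _ "C + D"] exI[of _ "k + l"]) auto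
next
  case (mult f g)
  then obtain C k D l where *: "0 \<le> C" "\<And>x. \<bar>f x\<bar> \<le> C * (1 + norm x) ^ k"
    "0 \<le> D" "\<And>x. \<bar>g x\<bar> \<le> D * (1 + norm x) ^ l" by metis
  have "\<bar>f x * g x\<bar> \<le> (C * D) * (1 + norm x) ^ (k + l)" for x
  proof -
    have "\<bar>f x\<bar> * \<bar>g x\<bar> \<le> (C * (1 + norm x) ^ k) * (D * (1 + norm x) ^ l)"
      using * by (intro mult_mono) auto
    then show ?thesis by (simp add: abs_mult power_add mult_ac)
  qed
  with * show ?case by (intro exI[of _ "C * D"] exI[of _ "k + l"]) auto
qed

text \<open>With 1 + r = (m + 1) t, the inequality t \<le> exp t bounds (1 + r)^m by (m + 1)^m exp
  (1 + r), and the quadratic exponent 1 + r - r^2 is at most 5/4. Dividing by m + 1 instead of m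
  covers m = 0.\<close>

lemma power_mult_exp_bounded:
  assumes "0 \<le> (r::real)"
  shows "(1 + r) ^ m * exp (- r\<^sup>2) \<le> real (m + 1) ^ m * exp 2"
proof -
  define t where "t = (1 + r) / real (m + 1)"
  have "0 \<le> t" using assms by (simp add: t_def)
  have "t ^ m \<le> exp t ^ m"
  proof (rule power_mono[OF _ \<open>0 \<le> t\<close>])
    show "t \<le> exp t" using exp_ge_add_one_self[of t] by linarith
  qed
  also have "\<dots> = exp (real m * t)" by (simp add: exp_of_nat_mult)
  also have "\<dots> \<le> exp (1 + r)"
  proof -
    have "real m * t \<le> real (m + 1) * t" using \<open>0 \<le> t\<close> by (intro mult_right_mono) auto
    also have "\<dots> = 1 + r" by (simp add: t_def)
    finally show ?thesis by simp
  qed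
  finally have "real (m + 1) ^ m * t ^ m \<le> real (m + 1) ^ m * exp (1 + r)"
    by (intro mult_left_mono) auto
  moreover have "(1 + r) ^ m = real (m + 1) ^ m * t ^ m"
    by (simp add: t_def flip: power_mult_distrib)
  ultimately have "(1 + r) ^ m * exp (- r\<^sup>2) \<le> real (m + 1) ^ m * exp (1 + r) * exp (- r\<^sup>2)"
    by (intro mult_right_mono) auto
  also have "\<dots> = real (m + 1) ^ m * exp (1 + r - r\<^sup>2)"
    by (simp add: exp_diff exp_minus divide_inverse)
  also have "\<dots> \<le> real (m + 1) ^ m * exp 2"
  proof -
    have "0 \<le> (r - 1/2)\<^sup>2" by simp
    then have "1 + r - r\<^sup>2 \<le> 2" by (simp add: power2_eq_square algebra_simps)
    then show ?thesis by (intro mult_left_mono) auto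
  qed
  finally show ?thesis .
qed

lemma gauss_poly_bounded:
  fixes p :: "real ^ 'n \<Rightarrow> real"
  assumes "real_polynomial_function p"
  shows "\<exists>C\<ge>0. \<forall>y. (1 + norm y) ^ j * norm (gauss_poly p y) \<le> C"
proof -
  obtain C k where *: "0 \<le> C" "\<And>y. \<bar>p y\<bar> \<le> C * (1 + norm y) ^ k"
    using real_polynomial_function_growth[OF assms] by blast
  have "(1 + norm y) ^ j * norm (gauss_poly p y) \<le> C * (real (j + k + 1) ^ (j + k) * exp 2)" for y
  proof -
    have "norm (gauss_poly p y) = \<bar>p y\<bar> * exp (- (norm y)\<^sup>2)"
      by (simp add: gauss_poly_def norm_mult power2_norm_eq_inner)
    also have "\<dots> \<le> C * (1 + norm y) ^ k * exp (- (norm y)\<^sup>2)"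
      by (intro mult_right_mono *) auto
    finally have "(1 + norm y) ^ j * norm (gauss_poly p y) \<le>
        (1 + norm y) ^ j * (C * (1 + norm y) ^ k * exp (- (norm y)\<^sup>2))"
      by (intro mult_left_mono) auto
    also have "\<dots> = C * ((1 + norm y) ^ (j + k) * exp (- (norm y)\<^sup>2))"
      by (simp add: power_add mult_ac)
    also have "\<dots> \<le> C * (real (j + k + 1) ^ (j + k) * exp 2)"
      by (intro mult_left_mono power_mult_exp_bounded *) auto
    finally show ?thesis .
  qed
  with *(1) show ?thesis by (intro exI[of _ "C * (real (j + k + 1) ^ (j + k) * exp 2)"]) auto
qed

lemma gauss_poly_has_derivative:
  fixes p :: "real ^ 'n \<Rightarrow> real"
  assumes "(p has_derivative D) (at y)"
  shows "(gauss_poly p has_derivative (\<lambda>v. of_real ((D v - 2 * (y \<bullet> v) * p y) * exp (- (y \<bullet> y))))) (at y)"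
  unfolding gauss_poly_def
  by (rule has_derivative_of_real, rule has_derivative_eq_rhs)
     (auto intro!: derivative_eq_intros assms simp: algebra_simps inner_commute)

lemma gauss_poly_partial:
  fixes p :: "real ^ 'n \<Rightarrow> real"
  assumes "real_polynomial_function p"
  shows "\<exists>q. real_polynomial_function q \<and> partial_deriv i (gauss_poly p) = gauss_poly q"
proof -
  obtain D where D: "\<And>x. (p has_derivative D x) (at x)" "\<And>v. real_polynomial_function (\<lambda>x. D x v)"
    using real_polynomial_function_has_derivative[OF assms] by metis
  define q where "q y = D y (axis i 1) + (- 2 * (y \<bullet> axis i 1)) * p y" for y
  have "bounded_linear (\<lambda>y::real^'n. - 2 * (y \<bullet> axis i 1))"
    by (rule bounded_linear_const_mult[OF bounded_linear_inner_left])
  then have "real_polynomial_function q"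
    unfolding q_def[abs_def]
    by (rule real_polynomial_function.intros(3)[OF D(2) real_polynomial_function.intros(4)[OF
          real_polynomial_function.intros(1) assms]])
  moreover have "partial_deriv i (gauss_poly p) = gauss_poly q"
  proof
    fix y
    show "partial_deriv i (gauss_poly p) y = gauss_poly q y"
      unfolding partial_deriv_eq[OF gauss_poly_has_derivative[OF D(1)]]
      by (simp add: gauss_poly_def q_def)
  qed
  ultimately show ?thesis by blast
qed

lemma gauss_poly_schwartz:
  fixes p :: "real ^ 'n \<Rightarrow> real"
  assumes "real_polynomial_function p"
  shows "gauss_poly p \<in> schwartz_space"
proof -
  let ?P = "\<lambda>g. \<exists>q. real_polynomial_function q \<and> g = gauss_poly q"
  have P_iter: "?P (iter_partial xs (gauss_poly p))" for xs
  proof (induction xs)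
    case Nil
    then show ?case using assms by auto
  next
    case (Cons a xs)
    then obtain q where q: "real_polynomial_function q" "iter_partial xs (gauss_poly p) = gauss_poly q"
      by (elim exE conjE)
    show ?case using gauss_poly_partial[OF q(1), of a] by (simp add: q(2))
  qed
  have "smooth (gauss_poly p)"
  proof (rule smooth_coinduct[where P = ?P])
    show "g differentiable at x" if "?P g" for g x
    proof -
      obtain q where q: "real_polynomial_function q" "g = gauss_poly q"
        using \<open>?P g\<close> by (elim exE conjE)
      then obtain D where "(q has_derivative D) (at x)"
        using real_polynomial_function_has_derivative by blast
      from gauss_poly_has_derivative[OF this] q(2) show ?thesis
        by (auto simp: differentiable_def)
    qed
    show "?P (partial_deriv i g)" if "?P g" for g i
    proof -
      obtain q where q: "real_polynomial_function q" "g = gauss_poly q"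
        using \<open>?P g\<close> by (elim exE conjE)
      show ?thesis using gauss_poly_partial[OF q(1), of i] by (simp add: q(2))
    qed
    show "?P (gauss_poly p)" by (rule exI[of _ p]) (simp add: assms)
  qed
  moreover have "\<exists>C\<ge>0. schwartz_bound j C (gauss_poly p)" for j
  proof -
    have "\<exists>C\<ge>0. \<forall>y. (1 + norm y) ^ j * norm (iter_partial xs (gauss_poly p) y) \<le> C" for xs
    proof -
      obtain q where q: "real_polynomial_function q" "iter_partial xs (gauss_poly p) = gauss_poly q"
        using P_iter[of xs] by (elim exE conjE)
      show ?thesis using gauss_poly_bounded[OF q(1), of j] by (simp add: q(2))
    qed
    then obtain C where *: "\<And>xs. 0 \<le> C xs"
      "\<And>xs y. (1 + norm y) ^ j * norm (iter_partial xs (gauss_poly p) y) \<le> C xs" by metis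
    define L where "L = {xs::'n list. length xs \<le> j}"
    have fin: "finite L"
      unfolding L_def using finite_lists_length_le[of "UNIV::'n set" j] by simp
    have "C xs \<le> sum C L" if "length xs \<le> j" for xs
      using that fin * by (auto simp: L_def intro!: member_le_sum)
    then have "schwartz_bound j (sum C L) (gauss_poly p)"
      unfolding schwartz_bound_def by (intro allI impI order_trans[OF *(2)])
    moreover have "0 \<le> sum C L" using * by (intro sum_nonneg) auto
    ultimately show ?thesis by (intro exI[of _ "sum C L"] conjI)
  qed
  ultimately show ?thesis unfolding schwartz_space_iff by (intro conjI allI)
qed

text \<open>The Gaussian is divided by its own integral \<open>I\<close>. If \<open>I\<close> were
  0, the nonnegative integrand would vanish almost everywhere, whereas it is positive at every
  point.\<close>

lemma ex_normalized_schwartz: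
  "\<exists>\<rho>. \<rho> \<in> schwartz_space \<and> (LINT y|lborel. \<rho> (y::real^'n)) = 1"
proof -
  define g where "g y = exp (- (y \<bullet> y))" for y :: "real^'n"
  define I where "I = (LINT y|lborel. g y)"
  have g: "gauss_poly (\<lambda>y. c) = (\<lambda>y. of_real (c * g y))" for c
    by (simp add: gauss_poly_def g_def)
  have sch: "gauss_poly (\<lambda>y::real^'n. c) \<in> schwartz_space" for c
    by (intro gauss_poly_schwartz real_polynomial_function.intros(2))
  have "integrable lborel (\<lambda>y. complex_of_real (g y))"
    using schwartz_integrable[OF sch, of 1] by (simp add: g)
  then have int: "integrable lborel g" by (simp add: complex_of_real_integrable_eq)
  have "I \<noteq> 0"
  proof
    assume "I = 0"
    then have "AE y in lborel. g y = 0"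
      using int unfolding I_def by (subst (asm) integral_nonneg_eq_0_iff_AE) (auto simp: g_def)
    then have "AE y in (lborel :: (real^'n) measure). False" by (simp add: g_def)
    then show False by (simp add: AE_iff_null null_sets_def)
  qed
  moreover have "(LINT y|lborel. gauss_poly (\<lambda>y::real^'n. 1 / I) y) = of_real (1 / I * I)"
    by (simp only: g integral_complex_of_real I_def integral_mult_right_zero)
  ultimately show ?thesis
    by (intro exI[of _ "gauss_poly (\<lambda>y. 1 / I)"]) (simp add: sch)
qed

section \<open>The mollifier\<close>

definition rescaled :: "(real ^ 'n \<Rightarrow> complex) \<Rightarrow> real \<Rightarrow> real ^ 'n \<Rightarrow> real ^ 'n \<Rightarrow> complex" where
  "rescaled \<rho> h x y = of_real ((1 / h) ^ CARD('n)) * \<rho> ((1 / h) *\<^sub>R (y - x))"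

text \<open>The weight at width (k + 1) h is the negative of the coefficient (-1)^(k+1) (M choose
  (k+1)) in the alternating binomial sum. The term of width 0 would be evaluation at
  \<open>x\<close>; it is left out here and reappears as the \<open>u x\<close> with which the
  integral is compared.\<close>

definition mollifier :: "(real ^ 'n \<Rightarrow> complex) \<Rightarrow> nat \<Rightarrow> real \<Rightarrow> real ^ 'n \<Rightarrow> real ^ 'n \<Rightarrow> complex" where
  "mollifier \<rho> M h x y =
     (\<Sum>k<M. ((- 1) ^ k * of_nat (M choose Suc k)) * rescaled \<rho> (real (Suc k) * h) x y)"

lemma smooth_rescaled: "smooth \<rho> \<Longrightarrow> smooth (rescaled \<rho> h x)"
  unfolding rescaled_def[abs_def] by (intro smooth_cmult iter_partial_affine(1))

lemma smooth_mollifier: "smooth \<rho> \<Longrightarrow> smooth (mollifier \<rho> M h x)"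
  unfolding mollifier_def[abs_def] by (intro smooth_sum smooth_cmult smooth_rescaled)

lemma one_plus_norm_add_le: "1 + norm (a + b) \<le> (1 + norm a) * (1 + norm b)"
proof -
  have "(1 + norm a) * (1 + norm b) = 1 + (norm a + norm b) + norm a * norm b"
    by (simp add: algebra_simps)
  moreover have "0 \<le> norm a * norm b" by simp
  ultimately show ?thesis using norm_triangle_ineq[of a b] by linarith
qed

text \<open>Submultiplicativity of 1 + |.| separates the centre x, which is merely moderate in
  \<epsilon>, from the variable z, whose powers the decay of \<rho> absorbs. The restriction to s
  \<le> 1 is what makes widths above 1 undesirable.\<close>

lemma one_plus_norm_affine_le:
  fixes x z :: "'a::real_normed_vector"
  assumes "0 \<le> s" "s \<le> 1"
  shows "(1 + norm (x + s *\<^sub>R z)) ^ N \<le> (1 + norm x) ^ N * (1 + norm z) ^ N"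
proof -
  have "norm (s *\<^sub>R z) \<le> norm z"
    using assms by (simp add: mult_left_le_one_le)
  then have "(1 + norm x) * (1 + norm (s *\<^sub>R z)) \<le> (1 + norm x) * (1 + norm z)"
    by (intro mult_left_mono) auto
  with one_plus_norm_add_le[of x "s *\<^sub>R z"]
  have "1 + norm (x + s *\<^sub>R z) \<le> (1 + norm x) * (1 + norm z)" by linarith
  then have "(1 + norm (x + s *\<^sub>R z)) ^ N \<le> ((1 + norm x) * (1 + norm z)) ^ N"
    by (intro power_mono) auto
  then show ?thesis by (simp only: power_mult_distrib)
qed

text \<open>The factors have separate origins: (1/h)^n is the normalisation, (1/h)^j comes from at
  most j derivatives with h \<le> 1, and (1 + |x|)^j from moving the weight to the centre
  \<open>x\<close>.\<close>

lemma schwartz_bound_rescaled: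
  fixes \<rho> :: "real ^ 'n \<Rightarrow> complex"
  assumes "smooth \<rho>" "schwartz_bound j A \<rho>" "0 < h" "h \<le> 1" "0 \<le> A"
  shows "schwartz_bound j (A * (1 + norm x) ^ j * (1 / h) ^ (CARD('n) + j)) (rescaled \<rho> h x)"
  unfolding schwartz_bound_def
proof (intro allI impI)
  fix xs :: "'n list" and y :: "real ^ 'n" assume len: "length xs \<le> j"
  define w where "w = (1 / h) *\<^sub>R (y - x)"
  have y: "y = x + h *\<^sub>R w" using assms(3) by (simp add: w_def)
  have "iter_partial xs (rescaled \<rho> h x) =
      (\<lambda>y. of_real ((1 / h) ^ CARD('n)) * iter_partial xs (\<lambda>y. \<rho> ((1 / h) *\<^sub>R (y - x))) y)"
    unfolding rescaled_def[abs_def] by (intro iter_partial_cmult iter_partial_affine(1) assms)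
  then have eq: "norm (iter_partial xs (rescaled \<rho> h x) y) =
      (1 / h) ^ CARD('n) * ((1 / h) ^ length xs * norm (iter_partial xs \<rho> w))"
    using assms(3) by (simp add: iter_partial_affine(2)[OF assms(1)] norm_mult norm_power w_def norm_divide)
  have "(1 + norm y) ^ j * norm (iter_partial xs (rescaled \<rho> h x) y) =
      (1 + norm y) ^ j * ((1 / h) ^ CARD('n) * ((1 / h) ^ length xs * norm (iter_partial xs \<rho> w)))"
    by (simp only: eq)
  also have "\<dots>
      \<le> ((1 + norm x) ^ j * (1 + norm w) ^ j) * ((1 / h) ^ CARD('n) * ((1 / h) ^ j * norm (iter_partial xs \<rho> w)))"
    using assms(3,4) len unfolding y
    by (intro mult_mono one_plus_norm_affine_le mult_nonneg_nonneg power_increasing) auto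
  also have "\<dots> = (1 + norm x) ^ j * ((1 + norm w) ^ j * norm (iter_partial xs \<rho> w)) * (1 / h) ^ (CARD('n) + j)"
    by (simp only: power_add mult_ac)
  also have "\<dots> \<le> (1 + norm x) ^ j * A * (1 / h) ^ (CARD('n) + j)"
    using assms(2,3) len by (intro mult_right_mono mult_left_mono) (auto simp: schwartz_bound_def)
  finally show "(1 + norm y) ^ j * norm (iter_partial xs (rescaled \<rho> h x) y) \<le>
      A * (1 + norm x) ^ j * (1 / h) ^ (CARD('n) + j)"
    by (simp only: mult_ac)
qed

text \<open>All widths lie between h and 1, so each term obeys the bound for width h, and the
  binomial weights sum to at most 2^M.\<close>

lemma schwartz_bound_mollifier:
  fixes \<rho> :: "real ^ 'n \<Rightarrow> complex"
  assumes "smooth \<rho>" "schwartz_bound j A \<rho>" "0 < h" "real M * h \<le> 1" "0 \<le> A"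
  shows "schwartz_bound j (2 ^ M * (A * (1 + norm x) ^ j * (1 / h) ^ (CARD('n) + j))) (mollifier \<rho> M h x)"
  unfolding schwartz_bound_def
proof (intro allI impI)
  fix xs :: "'n list" and y :: "real ^ 'n" assume len: "length xs \<le> j"
  define K where "K = A * (1 + norm x) ^ j * (1 / h) ^ (CARD('n) + j)"
  have "0 \<le> K" using assms by (simp add: K_def)
  have k: "(1 + norm y) ^ j * norm (iter_partial xs (rescaled \<rho> (real (Suc k) * h) x) y) \<le> K" if "k < M" for k
  proof -
    define s where "s = real (Suc k) * h"
    have "real (Suc k) * h \<le> real M * h"
      using that assms(3) by (intro mult_right_mono) auto
    then have "s \<le> 1" using assms(4) by (simp add: s_def)
    moreover have "h \<le> s" using assms(3) by (simp add: s_def distrib_right)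
    ultimately have s: "h \<le> s" "s \<le> 1" "0 < s" using assms(3) by auto
    have "(1 + norm y) ^ j * norm (iter_partial xs (rescaled \<rho> s x) y) \<le>
        A * (1 + norm x) ^ j * (1 / s) ^ (CARD('n) + j)"
      using schwartz_bound_rescaled[OF assms(1,2) s(3,2) assms(5), of x] len by (simp add: schwartz_bound_def)
    also have "\<dots> \<le> K"
      unfolding K_def using s assms by (intro mult_left_mono power_mono divide_left_mono) auto
    finally show ?thesis by (simp add: s_def)
  qed
  have "iter_partial xs (mollifier \<rho> M h x) y =
      (\<Sum>k<M. ((- 1) ^ k * of_nat (M choose Suc k)) * iter_partial xs (rescaled \<rho> (real (Suc k) * h) x) y)"
    unfolding mollifier_def[abs_def]
    by (simp add: iter_partial_sum iter_partial_cmult smooth_cmult smooth_rescaled assms(1) del: of_nat_Suc)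
  also have "norm \<dots> \<le> (\<Sum>k<M. real (M choose Suc k) * norm (iter_partial xs (rescaled \<rho> (real (Suc k) * h) x) y))"
    by (rule order_trans[OF norm_sum]) (simp add: norm_mult norm_power)
  finally have "(1 + norm y) ^ j * norm (iter_partial xs (mollifier \<rho> M h x) y) \<le>
      (1 + norm y) ^ j * (\<Sum>k<M. real (M choose Suc k) * norm (iter_partial xs (rescaled \<rho> (real (Suc k) * h) x) y))"
    by (intro mult_left_mono) auto
  also have "\<dots> = (\<Sum>k<M. real (M choose Suc k) *
      ((1 + norm y) ^ j * norm (iter_partial xs (rescaled \<rho> (real (Suc k) * h) x) y)))"
    by (simp add: sum_distrib_left mult_ac)
  also have "\<dots> \<le> (\<Sum>k<M. real (M choose Suc k) * K)"
    by (intro sum_mono mult_left_mono k) auto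
  also have "\<dots> = (\<Sum>k<M. real (M choose Suc k)) * K"
    by (simp add: sum_distrib_right)
  also have "\<dots> \<le> 2 ^ M * K"
  proof (rule mult_right_mono[OF _ \<open>0 \<le> K\<close>])
    have "(\<Sum>k<M. real (M choose Suc k)) \<le> (\<Sum>k\<le>M. real (M choose k))"
      by (simp add: sum.atMost_shift)
    also have "\<dots> = 2 ^ M"
      by (simp add: choose_row_sum flip: of_nat_sum)
    finally show "(\<Sum>k<M. real (M choose Suc k)) \<le> 2 ^ M" .
  qed
  finally show "(1 + norm y) ^ j * norm (iter_partial xs (mollifier \<rho> M h x) y) \<le>
      2 ^ M * (A * (1 + norm x) ^ j * (1 / h) ^ (CARD('n) + j))"
    unfolding K_def .
qed

lemma mollifier_schwartz:
  fixes \<rho> :: "real ^ 'n \<Rightarrow> complex"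
  assumes "\<rho> \<in> schwartz_space" "0 < h" "real M * h \<le> 1"
  shows "mollifier \<rho> M h x \<in> schwartz_space"
  unfolding schwartz_space_iff
proof (intro conjI allI)
  have sm: "smooth \<rho>" using assms(1) by (simp add: schwartz_space_iff)
  then show "smooth (mollifier \<rho> M h x)" by (rule smooth_mollifier)
  fix j
  obtain A where A: "0 \<le> A" "schwartz_bound j A \<rho>"
    using assms(1) unfolding schwartz_space_iff by blast
  have "0 \<le> 2 ^ M * (A * (1 + norm x) ^ j * (1 / h) ^ (CARD('n) + j))"
    using A assms(2) by simp
  with schwartz_bound_mollifier[OF sm A(2) assms(2,3) A(1), of x]
  show "\<exists>C\<ge>0. schwartz_bound j C (mollifier \<rho> M h x)"
    by (intro exI conjI)
qed

lemma integral_rescaled_mult: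
  fixes \<rho> u :: "real ^ 'n \<Rightarrow> complex"
  assumes "smooth \<rho>" "smooth u" "0 < h"
  shows "(LINT y|lborel. rescaled \<rho> h x y * u y) = (LINT z|lborel. \<rho> z * u (x + h *\<^sub>R z))"
proof -
  have "(\<lambda>y. rescaled \<rho> h x y * u y) \<in> borel_measurable borel"
    by (intro borel_measurable_continuous_onI smooth_continuous_on smooth_mult smooth_rescaled assms)
  from lborel_integral_affine[OF this, of h x]
  have "(LINT y|lborel. rescaled \<rho> h x y * u y) =
      h ^ CARD('n) *\<^sub>R (LINT z|lborel. of_real ((1 / h) ^ CARD('n)) * (\<rho> z * u (x + h *\<^sub>R z)))"
    using assms(3) by (simp add: rescaled_def mult.assoc)
  also have "\<dots> = (LINT z|lborel. \<rho> z * u (x + h *\<^sub>R z))"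
    using assms(3) by (subst integral_mult_right_zero) (simp add: scaleR_conv_of_real power_one_over)
  finally show ?thesis .
qed

text \<open>The weight order required of \<rho> has three parts: q for the factor |z|^q of the q-th
  directional derivative, N for the growth of \<open>u\<close> in z, and 2n for integrability. The
  powers of 1 + |x| leave the integral as a constant.\<close>

lemma mollifier_error:
  fixes \<rho> u :: "real ^ 'n \<Rightarrow> complex"
  assumes \<rho>: "smooth \<rho>" "schwartz_bound (2 * CARD('n) + q + N) A \<rho>" "(LINT y|lborel. \<rho> y) = 1"
    and u: "smooth u" "growth_bound N q B u"
    and "0 \<le> B" "0 < h" "real M * h \<le> 1" "q \<le> M"
  shows "norm ((LINT y|lborel. mollifier \<rho> M h x y * u y) - u x) \<le>
      (2 ^ M * h ^ q * (real CARD('n) ^ q * B * (1 + norm x) ^ N) * A) * (LINT y|lborel. decay (y::real^'n))"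
proof -
  define c where "c k = (- 1) ^ k * (of_nat (M choose k) :: complex)" for k
  define f where "f k z = \<rho> z * u (x + (real k * h) *\<^sub>R z)" for k z
  define n where "n = CARD('n)"
  have rho: "(1 + norm z) ^ (2 * n) * ((1 + norm z) ^ q * (1 + norm z) ^ N * norm (\<rho> z)) \<le> A" for z
    using schwartz_bound_value[OF \<rho>(2), of z] by (simp add: power_add mult.assoc n_def)
  have cont: "continuous_on UNIV (f k)" for k
    unfolding f_def[abs_def]
    by (intro continuous_intros smooth_continuous_on \<rho> smooth_continuous_compose u)
  have kh: "0 \<le> real k * h" "real k * h \<le> 1" if "k \<le> M" for k
  proof -
    have "real k * h \<le> real M * h" using that assms by (intro mult_right_mono) auto
    then show "real k * h \<le> 1" using assms by linarith
    show "0 \<le> real k * h" using assms by simp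
  qed
  \<comment> \<open>This bound is uniform in s, so it covers both the nodes s = kh and the
    intermediate points at which derivatives are evaluated.\<close>
  have ub: "norm (iter_partial xs u (x + s *\<^sub>R z)) \<le> B * ((1 + norm x) ^ N * (1 + norm z) ^ N)"
    if "length xs \<le> q" "0 \<le> s" "s \<le> 1" for xs s z
  proof -
    have "norm (iter_partial xs u (x + s *\<^sub>R z)) \<le> B * (1 + norm (x + s *\<^sub>R z)) ^ N"
      using u(2) that by (simp add: growth_bound_def)
    also have "\<dots> \<le> B * ((1 + norm x) ^ N * (1 + norm z) ^ N)"
      using that assms by (intro mult_left_mono one_plus_norm_affine_le) auto
    finally show ?thesis .
  qed
  have int: "integrable lborel (f k)" if "k \<le> M" for k
  proof (rule rapidly_decreasing_integrable[OF cont])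
    fix z :: "real ^ 'n"
    have "norm (f k z) \<le> norm (\<rho> z) * (B * ((1 + norm x) ^ N * (1 + norm z) ^ N))"
      unfolding f_def norm_mult using ub[of "[]" "real k * h" z] kh[OF that]
      by (intro mult_left_mono) auto
    also have "\<dots> \<le> (1 + norm z) ^ q * (norm (\<rho> z) * (B * ((1 + norm x) ^ N * (1 + norm z) ^ N)))"
    proof -
      have "1 * K \<le> (1 + norm z) ^ q * K" if "0 \<le> K" for K
        using that by (intro mult_right_mono one_le_power) auto
      then show ?thesis using assms by simp
    qed
    finally have "(1 + norm z) ^ (2 * n) * norm (f k z) \<le>
        (1 + norm z) ^ (2 * n) * ((1 + norm z) ^ q * (norm (\<rho> z) * (B * ((1 + norm x) ^ N * (1 + norm z) ^ N))))"
      by (intro mult_left_mono) auto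
    also have "\<dots> = (B * (1 + norm x) ^ N) * ((1 + norm z) ^ (2 * n) * ((1 + norm z) ^ q * (1 + norm z) ^ N * norm (\<rho> z)))"
      by (simp add: mult_ac)
    also have "\<dots> \<le> (B * (1 + norm x) ^ N) * A"
      using assms by (intro mult_left_mono rho) auto
    finally show "(1 + norm z) ^ (2 * CARD('n)) * norm (f k z) \<le> (B * (1 + norm x) ^ N) * A"
      by (simp add: n_def)
  qed
  have "0 \<le> A"
    using schwartz_bound_value[OF \<rho>(2), of 0] by (simp add: order_trans[OF norm_ge_zero])
  have intk: "integrable lborel (\<lambda>y. rescaled \<rho> (real (Suc k) * h) x y * u y)" if "k < M" for k
  proof -
    define s where "s = real (Suc k) * h"
    have s: "0 < s" "s \<le> 1" using kh[of "Suc k"] that assms by (auto simp: s_def)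
    define J where "J = 2 * n + q + N"
    define A' where "A' = A * (1 + norm x) ^ J * (1 / s) ^ (CARD('n) + J)"
    have "schwartz_bound J A' (rescaled \<rho> s x)"
      unfolding A'_def by (rule schwartz_bound_rescaled) (use \<rho> s \<open>0 \<le> A\<close> in \<open>auto simp: J_def n_def\<close>)
    note K = schwartz_bound_value[OF this]
    show ?thesis
      unfolding s_def[symmetric]
    proof (rule rapidly_decreasing_integrable)
      show "continuous_on UNIV (\<lambda>y. rescaled \<rho> s x y * u y)"
        by (intro smooth_continuous_on smooth_mult smooth_rescaled \<rho> u)
      fix y :: "real ^ 'n"
      have "(1 + norm y) ^ (2 * n) * norm (rescaled \<rho> s x y * u y) \<le>
          (1 + norm y) ^ (2 * n) * (norm (rescaled \<rho> s x y) * (B * (1 + norm y) ^ N))"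
        unfolding norm_mult using u(2)[unfolded growth_bound_def, rule_format, of "[]" y]
        by (intro mult_left_mono) auto
      also have "\<dots> = (1 + norm y) ^ (2 * n + N) * (norm (rescaled \<rho> s x y) * B)"
        by (simp add: power_add mult_ac)
      also have "\<dots> \<le> (1 + norm y) ^ J * (norm (rescaled \<rho> s x y) * B)"
        using assms by (intro mult_right_mono power_increasing) (auto simp: J_def)
      also have "\<dots> \<le> A' * B"
        using K[of y] assms by (simp add: mult.assoc[symmetric] mult_right_mono)
      finally show "(1 + norm y) ^ (2 * CARD('n)) * norm (rescaled \<rho> s x y * u y) \<le> A' * B"
        by (simp add: n_def)
    qed
  qed
  define E where "E z = (\<Sum>k\<le>M. c k * f k z)" for z
  have "(LINT y|lborel. mollifier \<rho> M h x y * u y) =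
      (LINT y|lborel. (\<Sum>k<M. - c (Suc k) * (rescaled \<rho> (real (Suc k) * h) x y * u y)))"
    by (simp add: mollifier_def c_def sum_distrib_right mult.assoc del: of_nat_Suc)
  also have "\<dots> = (\<Sum>k<M. - c (Suc k) * (LINT y|lborel. rescaled \<rho> (real (Suc k) * h) x y * u y))"
  proof (subst Bochner_Integration.integral_sum)
    fix k assume "k \<in> {..<M}"
    then show "integrable lborel (\<lambda>y. - c (Suc k) * (rescaled \<rho> (real (Suc k) * h) x y * u y))"
      by (intro integrable_mult_right intk) auto
  qed simp
  also have "\<dots> = (\<Sum>k<M. - c (Suc k) * (LINT z|lborel. f (Suc k) z))"
    using assms by (intro sum.cong refl arg_cong2[where f = "(*)"]) (simp add: integral_rescaled_mult f_def)
  finally have 1: "(LINT y|lborel. mollifier \<rho> M h x y * u y) = (\<Sum>k<M. - c (Suc k) * (LINT z|lborel. f (Suc k) z))" .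
  \<comment> \<open>Since \<rho> has integral 1, the point value is the missing term k = 0 and
    completes the binomial sum.\<close>
  have "(LINT z|lborel. f 0 z) = u x"
    by (simp add: f_def \<rho>(3))
  then have "u x - (LINT y|lborel. mollifier \<rho> M h x y * u y) = (\<Sum>k\<le>M. c k * (LINT z|lborel. f k z))"
    unfolding 1 sum.atMost_shift by (simp add: c_def sum_negf)
  also have "\<dots> = (LINT z|lborel. E z)"
    unfolding E_def using int by (subst Bochner_Integration.integral_sum) auto
  finally have 2: "norm ((LINT y|lborel. mollifier \<rho> M h x y * u y) - u x) = norm (LINT z|lborel. E z)"
    by (metis norm_minus_commute)
  show ?thesis
    unfolding 2
  proof (rule norm_integral_le_decay)
    show "continuous_on UNIV E"
      unfolding E_def[abs_def] by (intro continuous_intros cont)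
    fix z :: "real ^ 'n"
    \<comment> \<open>For fixed z, these are the successive derivatives of t \<mapsto> u(x + tz),
      the family to which the mixed difference estimate applies.\<close>
    define G where "G k t = (dir_deriv z ^^ k) u (x + t *\<^sub>R z)" for k t
    have "E z = \<rho> z * (\<Sum>k\<le>M. c k * G 0 (0 + real k * h))"
      by (simp add: E_def f_def G_def sum_distrib_left mult_ac)
    \<comment> \<open>The coefficients differ from those of the M-th difference by the global sign
      (-1)^M, which disappears in the norm.\<close>
    also have "(\<Sum>k\<le>M. c k * G 0 (0 + real k * h)) = (- 1) ^ M * (fdiff h ^^ M) (G 0) 0"
      unfolding fdiff_funpow by (simp add: sum_distrib_left c_def power_add flip: mult.assoc power_mult_distrib)
    finally have Ez: "norm (E z) = norm (\<rho> z) * norm ((fdiff h ^^ M) (G 0) 0)"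
      by (simp add: norm_mult norm_power)
    have "norm ((fdiff h ^^ M) (G 0) 0) \<le>
        2 ^ M * h ^ q * ((real n * norm z) ^ q * (B * ((1 + norm x) ^ N * (1 + norm z) ^ N)))"
    proof (rule norm_fdiff_mixed_le)
      show "(G k has_vector_derivative G (Suc k) t) (at t)" for k t
        using has_vector_derivative_dir_deriv[OF smooth_dir_deriv_funpow[OF u(1)], of k z x z t]
        by (simp add: G_def[abs_def])
      show "norm (G q t) \<le> (real n * norm z) ^ q * (B * ((1 + norm x) ^ N * (1 + norm z) ^ N))"
        if "0 \<le> t" "t \<le> 1" for t
        unfolding G_def n_def using that by (intro norm_dir_deriv_funpow_le u ub) auto
    qed (use assms in auto)
    also have "\<dots> \<le> 2 ^ M * h ^ q * ((real n ^ q * (1 + norm z) ^ q) * (B * ((1 + norm x) ^ N * (1 + norm z) ^ N)))"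
      using assms unfolding power_mult_distrib
      by (intro mult_left_mono mult_right_mono power_mono mult_nonneg_nonneg) auto
    finally have "(1 + norm z) ^ (2 * n) * norm (E z) \<le> (1 + norm z) ^ (2 * n) * (norm (\<rho> z) *
        (2 ^ M * h ^ q * ((real n ^ q * (1 + norm z) ^ q) * (B * ((1 + norm x) ^ N * (1 + norm z) ^ N)))))"
      unfolding Ez by (intro mult_left_mono) auto
    also have "\<dots> = (2 ^ M * h ^ q * (real n ^ q * B * (1 + norm x) ^ N)) *
        ((1 + norm z) ^ (2 * n) * ((1 + norm z) ^ q * (1 + norm z) ^ N * norm (\<rho> z)))"
      by (simp add: mult_ac)
    also have "\<dots> \<le> (2 ^ M * h ^ q * (real n ^ q * B * (1 + norm x) ^ N)) * A"
      using assms by (intro mult_left_mono rho) auto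
    finally show "(1 + norm z) ^ (2 * CARD('n)) * norm (E z) \<le>
        2 ^ M * h ^ q * (real CARD('n) ^ q * B * (1 + norm x) ^ N) * A"
      by (simp add: n_def)
  qed
qed

section \<open>Nets\<close>

text \<open>Negative integer powers of \<epsilon> become natural powers of 1 / \<epsilon>. These
  multiply by addition of exponents and are cancelled by \<open>power_cancel_one_over\<close>, the
  pattern of all later estimates.\<close>

lemma moderate_iff:
  "x \<in> moderate_nets \<longleftrightarrow> (\<exists>N C. 0 \<le> C \<and> (\<forall>\<^sub>F \<epsilon> in at_right 0. norm (x \<epsilon>) \<le> C * (1 / \<epsilon>) ^ N))"
  unfolding moderate_nets_iff by (simp add: power_int_minus power_one_over inverse_eq_divide)

lemma eventually_seminorm_le_iff:
  fixes u :: "real \<Rightarrow> real ^ 'n \<Rightarrow> complex" and c :: "real \<Rightarrow> real"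
  assumes "\<forall>\<epsilon>\<in>{0<..1}. smooth (u \<epsilon>)" "\<And>\<epsilon>. 0 < \<epsilon> \<Longrightarrow> 0 \<le> c \<epsilon>"
  shows "(\<forall>\<^sub>F \<epsilon> in at_right 0. schwartz_seminorm j (u \<epsilon>) \<le> ennreal (c \<epsilon>)) \<longleftrightarrow>
      (\<forall>\<^sub>F \<epsilon> in at_right 0. schwartz_bound j (c \<epsilon>) (u \<epsilon>))"
proof (rule eventually_subst)
  show "\<forall>\<^sub>F \<epsilon> in at_right 0. (schwartz_seminorm j (u \<epsilon>) \<le> ennreal (c \<epsilon>)) = schwartz_bound j (c \<epsilon>) (u \<epsilon>)"
    by (rule eventually_mono[OF eventually_unit_interval])
       (intro schwartz_seminorm_le_iff assms(2) bspec[OF assms(1)], auto)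
qed

lemma E_S_iff:
  "u \<in> E_S \<longleftrightarrow> (\<forall>\<epsilon>\<in>{0<..1}. u \<epsilon> \<in> schwartz_space) \<and>
     (\<forall>j. \<exists>N C. 0 \<le> C \<and> (\<forall>\<^sub>F \<epsilon> in at_right 0. schwartz_bound j (C * (1 / \<epsilon>) ^ N) (u \<epsilon>)))"
proof (cases "\<forall>\<epsilon>\<in>{0<..1}. u \<epsilon> \<in> schwartz_space")
  case True
  then have sm: "\<forall>\<epsilon>\<in>{0<..1}. smooth (u \<epsilon>)" by (auto simp: schwartz_space_def)
  have "bigO_net (\<lambda>\<epsilon>. schwartz_seminorm j (u \<epsilon>)) (- int N) \<longleftrightarrow>
      (\<exists>C\<ge>0. \<forall>\<^sub>F \<epsilon> in at_right 0. schwartz_bound j (C * (1 / \<epsilon>) ^ N) (u \<epsilon>))" for j N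
    unfolding bigO_net_iff power_int_minus power_int_of_nat inverse_eq_divide power_one_over
    by (intro ex_cong1 conj_cong refl eventually_seminorm_le_iff sm) auto
  with True show ?thesis unfolding E_S_def by auto
qed (auto simp: E_S_def)

lemma N_S_iff:
  "u \<in> N_S \<longleftrightarrow> (\<forall>\<epsilon>\<in>{0<..1}. u \<epsilon> \<in> schwartz_space) \<and>
     (\<forall>j q. \<exists>C\<ge>0. \<forall>\<^sub>F \<epsilon> in at_right 0. schwartz_bound j (C * \<epsilon> ^ q) (u \<epsilon>))"
proof (cases "\<forall>\<epsilon>\<in>{0<..1}. u \<epsilon> \<in> schwartz_space")
  case True
  then have sm: "\<forall>\<epsilon>\<in>{0<..1}. smooth (u \<epsilon>)" by (auto simp: schwartz_space_def)
  have "bigO_net (\<lambda>\<epsilon>. schwartz_seminorm j (u \<epsilon>)) (int q) \<longleftrightarrow>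
      (\<exists>C\<ge>0. \<forall>\<^sub>F \<epsilon> in at_right 0. schwartz_bound j (C * \<epsilon> ^ q) (u \<epsilon>))" for j q
    unfolding bigO_net_iff power_int_of_nat
    by (intro ex_cong1 conj_cong refl eventually_seminorm_le_iff sm) auto
  with True show ?thesis unfolding N_S_def by auto
qed (auto simp: N_S_def)

lemma multi_deriv_0: "multi_deriv (\<lambda>_. 0) f = (f :: real ^ 'n \<Rightarrow> complex)"
proof -
  have "concat (map (\<lambda>i. []) cs) = ([] :: 'n list)" for cs :: "'n list"
    by (induction cs) auto
  then show ?thesis unfolding multi_deriv_eq_iter replicate_0 by (simp only: foldr.simps id_apply)
qed

text \<open>Only order 0 is extracted: arbitrary representatives of a tempered class enter solely
  through their values, under point evaluation or under the integral sign.\<close>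

lemma E_tau_growth:
  assumes "u \<in> E_tau"
  obtains N C where "0 \<le> C" "\<forall>\<^sub>F \<epsilon> in at_right 0. \<forall>y. norm (u \<epsilon> y) \<le> C * (1 / \<epsilon>) ^ N * (1 + norm y) ^ N"
proof -
  obtain N where "bigO_net (\<lambda>\<epsilon>. tempered_seminorm N (\<lambda>_. 0) (u \<epsilon>)) (- int N)"
    using assms unfolding E_tau_def by blast
  then obtain C where C: "0 \<le> C"
    "\<forall>\<^sub>F \<epsilon> in at_right 0. tempered_seminorm N (\<lambda>_. 0) (u \<epsilon>) \<le> ennreal (C * \<epsilon> powi (- int N))"
    unfolding bigO_net_iff by blast
  from C(2) eventually_unit_interval
  have "\<forall>\<^sub>F \<epsilon> in at_right 0. \<forall>y. norm (u \<epsilon> y) \<le> C * (1 / \<epsilon>) ^ N * (1 + norm y) ^ N"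
  proof eventually_elim
    case (elim \<epsilon>)
    have "0 \<le> C * \<epsilon> powi (- int N)" using C(1) elim by simp
    with elim show ?case
      using tempered_seminorm_le_iff[of "C * \<epsilon> powi (- int N)" N "\<lambda>_. 0" "u \<epsilon>"]
      by (simp add: multi_deriv_0 power_int_minus power_one_over inverse_eq_divide)
  qed
  with C(1) show ?thesis by (rule that)
qed

text \<open>The exponent \<open>N\<close> of the spatial growth precedes \<open>q\<close>. Hence
  \<open>q\<close> can be enlarged by an amount depending on \<open>N\<close> to compensate that
  growth.\<close>

lemma N_tau_growth:
  assumes "u \<in> N_tau"
  obtains N where "\<forall>q. \<exists>C\<ge>0. \<forall>\<^sub>F \<epsilon> in at_right 0. \<forall>y. norm (u \<epsilon> y) \<le> C * \<epsilon> ^ q * (1 + norm y) ^ N"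
proof -
  obtain N where N: "\<And>q. bigO_net (\<lambda>\<epsilon>. tempered_seminorm N (\<lambda>_. 0) (u \<epsilon>)) (int q)"
    using assms unfolding N_tau_def by blast
  have "\<exists>C\<ge>0. \<forall>\<^sub>F \<epsilon> in at_right 0. \<forall>y. norm (u \<epsilon> y) \<le> C * \<epsilon> ^ q * (1 + norm y) ^ N" for q
  proof -
    obtain C where C: "0 \<le> C"
      "\<forall>\<^sub>F \<epsilon> in at_right 0. tempered_seminorm N (\<lambda>_. 0) (u \<epsilon>) \<le> ennreal (C * \<epsilon> powi (int q))"
      using N[of q] unfolding bigO_net_iff by blast
    from C(2) eventually_unit_interval
    have "\<forall>\<^sub>F \<epsilon> in at_right 0. \<forall>y. norm (u \<epsilon> y) \<le> C * \<epsilon> ^ q * (1 + norm y) ^ N"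
    proof eventually_elim
      case (elim \<epsilon>)
      have "0 \<le> C * \<epsilon> ^ q" using C(1) elim by simp
      with elim show ?case
        using tempered_seminorm_le_iff[of "C * \<epsilon> ^ q" N "\<lambda>_. 0" "u \<epsilon>"]
        by (simp add: multi_deriv_0)
    qed
    with C(1) show ?thesis by (intro exI[of _ C] conjI)
  qed
  then show ?thesis by (intro that allI)
qed

text \<open>Regularity in usable form: \<open>N\<close> precedes the order \<open>j\<close>, and
  only the constant depends on \<open>j\<close>. The constants of the finitely many lists of length
  at most \<open>j\<close> are added, and the finitely many eventual estimates hold
  simultaneously.\<close>

lemma E_tau_inf_inf_growth:
  fixes u :: "real \<Rightarrow> real ^ 'n \<Rightarrow> complex"
  assumes "u \<in> E_tau_inf_inf"
  obtains N where "\<forall>j. \<exists>C\<ge>0. \<forall>\<^sub>F \<epsilon> in at_right 0. growth_bound N j (C * (1 / \<epsilon>) ^ N) (u \<epsilon>)"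
proof -
  have OM: "\<And>\<epsilon>. 0 < \<epsilon> \<Longrightarrow> \<epsilon> \<le> 1 \<Longrightarrow> smooth (u \<epsilon>)"
    using assms unfolding E_tau_inf_inf_def O_M_def by auto
  obtain N where N: "\<And>\<alpha>. bigO_net (\<lambda>\<epsilon>. tempered_seminorm N \<alpha> (u \<epsilon>)) (- int N)"
    using assms unfolding E_tau_inf_inf_def by blast
  define P where "P xs C \<longleftrightarrow> 0 \<le> C \<and>
      (\<forall>\<^sub>F \<epsilon> in at_right 0. \<forall>y. norm (iter_partial xs (u \<epsilon>) y) \<le> C * (1 / \<epsilon>) ^ N * (1 + norm y) ^ N)" for xs C
  have "\<exists>C. P xs C" for xs
  proof -
    obtain C where C: "0 \<le> C"
      "\<forall>\<^sub>F \<epsilon> in at_right 0. tempered_seminorm N (count_list xs) (u \<epsilon>) \<le> ennreal (C * \<epsilon> powi (- int N))"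
      using N[of "count_list xs"] unfolding bigO_net_iff by blast
    from C(2) eventually_unit_interval
    have "\<forall>\<^sub>F \<epsilon> in at_right 0. \<forall>y. norm (iter_partial xs (u \<epsilon>) y) \<le> C * (1 / \<epsilon>) ^ N * (1 + norm y) ^ N"
    proof eventually_elim
      case (elim \<epsilon>)
      have "0 \<le> C * \<epsilon> powi (- int N)" using C(1) elim by simp
      with elim show ?case
        using tempered_seminorm_le_iff[of "C * \<epsilon> powi (- int N)" N "count_list xs" "u \<epsilon>"]
        by (simp add: iter_eq_multi_deriv[OF OM] power_int_minus power_one_over inverse_eq_divide)
    qed
    with C(1) have "P xs C" unfolding P_def by (rule conjI)
    then show ?thesis by (rule exI)
  qed
  then obtain C where "\<And>xs. P xs (C xs)" by metis
  then have C: "\<And>xs. 0 \<le> C xs"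
    "\<And>xs. \<forall>\<^sub>F \<epsilon> in at_right 0. \<forall>y. norm (iter_partial xs (u \<epsilon>) y) \<le> C xs * (1 / \<epsilon>) ^ N * (1 + norm y) ^ N"
    unfolding P_def by (rule conjunct1, rule conjunct2)
  have "\<exists>C\<ge>0. \<forall>\<^sub>F \<epsilon> in at_right 0. growth_bound N j (C * (1 / \<epsilon>) ^ N) (u \<epsilon>)" for j
  proof -
    define L where "L = {xs::'n list. length xs \<le> j}"
    have fin: "finite L"
      unfolding L_def using finite_lists_length_le[of "UNIV::'n set" j] by simp
    have "\<forall>\<^sub>F \<epsilon> in at_right 0. \<forall>xs\<in>L. \<forall>y. norm (iter_partial xs (u \<epsilon>) y) \<le> C xs * (1 / \<epsilon>) ^ N * (1 + norm y) ^ N"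
      using C(2) by (intro eventually_ball_finite fin) auto
    with eventually_unit_interval
    have "\<forall>\<^sub>F \<epsilon> in at_right 0. growth_bound N j (sum C L * (1 / \<epsilon>) ^ N) (u \<epsilon>)"
    proof eventually_elim
      case (elim \<epsilon>)
      show ?case
        unfolding growth_bound_def
      proof (intro allI impI)
        fix xs :: "'n list" and y :: "real ^ 'n" assume "length xs \<le> j"
        then have "xs \<in> L" by (simp add: L_def)
        then have "C xs \<le> sum C L" using fin C(1) by (intro member_le_sum) auto
        then have "C xs * (1 / \<epsilon>) ^ N * (1 + norm y) ^ N \<le> sum C L * (1 / \<epsilon>) ^ N * (1 + norm y) ^ N"
          using elim(1) by (intro mult_right_mono) auto
        then show "norm (iter_partial xs (u \<epsilon>) y) \<le> sum C L * (1 / \<epsilon>) ^ N * (1 + norm y) ^ N"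
          by (rule order_trans[OF elim(2)[rule_format, OF \<open>xs \<in> L\<close>]])
      qed
    qed
    moreover have "0 \<le> sum C L" using C(1) by (intro sum_nonneg) auto
    ultimately show ?thesis by (intro exI[of _ "sum C L"] conjI)
  qed
  then show ?thesis by (intro that allI)
qed

section \<open>Negligible nets and the equivalence of nets of numbers and points\<close>

lemma negligible_nets_add:
  assumes "x \<in> negligible_nets" "y \<in> negligible_nets"
  shows "(\<lambda>\<epsilon>. x \<epsilon> + y \<epsilon>) \<in> negligible_nets"
  unfolding negligible_nets_iff
proof
  fix q
  obtain C D where C: "0 \<le> C" "\<forall>\<^sub>F \<epsilon> in at_right 0. norm (x \<epsilon>) \<le> C * \<epsilon> ^ q"
    and D: "0 \<le> D" "\<forall>\<^sub>F \<epsilon> in at_right 0. norm (y \<epsilon>) \<le> D * \<epsilon> ^ q"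
    using assms unfolding negligible_nets_iff by blast
  from C(2) D(2) have "\<forall>\<^sub>F \<epsilon> in at_right 0. norm (x \<epsilon> + y \<epsilon>) \<le> (C + D) * \<epsilon> ^ q"
    by eventually_elim (simp add: norm_triangle_mono distrib_right)
  with C(1) D(1) show "\<exists>C\<ge>0. \<forall>\<^sub>F \<epsilon> in at_right 0. norm (x \<epsilon> + y \<epsilon>) \<le> C * \<epsilon> ^ q"
    by (intro exI[of _ "C + D"]) auto
qed

lemma negligible_nets_minus_commute:
  "(\<lambda>\<epsilon>. x \<epsilon> - y \<epsilon>) \<in> negligible_nets \<longleftrightarrow> (\<lambda>\<epsilon>. y \<epsilon> - x \<epsilon>) \<in> negligible_nets"
  by (simp add: negligible_nets_iff norm_minus_commute)

lemma negligible_nets_diff_trans: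
  assumes "(\<lambda>\<epsilon>. x \<epsilon> - y \<epsilon>) \<in> negligible_nets" "(\<lambda>\<epsilon>. y \<epsilon> - z \<epsilon>) \<in> negligible_nets"
  shows "(\<lambda>\<epsilon>. x \<epsilon> - z \<epsilon>) \<in> negligible_nets"
  using negligible_nets_add[OF assms] by simp

lemma zero_negligible: "(\<lambda>\<epsilon>. 0) \<in> negligible_nets"
  by (auto simp: negligible_nets_iff)

lemma negligible_cong:
  assumes "x \<in> negligible_nets" "\<forall>\<^sub>F \<epsilon> in at_right 0. y \<epsilon> = x \<epsilon>"
  shows "y \<in> negligible_nets"
  unfolding negligible_nets_iff
proof
  fix q
  obtain C where C: "0 \<le> C" "\<forall>\<^sub>F \<epsilon> in at_right 0. norm (x \<epsilon>) \<le> C * \<epsilon> ^ q"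
    using assms(1) unfolding negligible_nets_iff by blast
  from C(2) assms(2) have "\<forall>\<^sub>F \<epsilon> in at_right 0. norm (y \<epsilon>) \<le> C * \<epsilon> ^ q"
    by eventually_elim simp
  with C(1) show "\<exists>C\<ge>0. \<forall>\<^sub>F \<epsilon> in at_right 0. norm (y \<epsilon>) \<le> C * \<epsilon> ^ q" by blast
qed

lemma equiv_net_rel: "equiv moderate_nets net_rel"
proof (rule equivI)
  show "refl_on moderate_nets net_rel"
    by (auto simp: refl_on_def net_rel_def zero_negligible)
  show "sym net_rel"
    by (auto simp: sym_def net_rel_def intro: negligible_nets_minus_commute[THEN iffD1])
  show "trans net_rel"
    unfolding trans_def net_rel_def using negligible_nets_diff_trans by blast
  show "net_rel \<subseteq> moderate_nets \<times> moderate_nets"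
    by (auto simp: net_rel_def)
qed

text \<open>A negligible difference is in particular bounded for small \<epsilon>, so
  \<open>b\<close> inherits moderateness from \<open>a\<close>. For two nets to be identified, it
  then remains only to estimate their difference.\<close>

lemma net_relI:
  assumes "a \<in> moderate_nets" "(\<lambda>\<epsilon>. a \<epsilon> - b \<epsilon>) \<in> negligible_nets"
  shows "(a, b) \<in> net_rel"
proof -
  obtain N C where C: "0 \<le> C" "\<forall>\<^sub>F \<epsilon> in at_right 0. norm (a \<epsilon>) \<le> C * (1 / \<epsilon>) ^ N"
    using assms(1) unfolding moderate_iff by blast
  obtain D where D: "0 \<le> D" "\<forall>\<^sub>F \<epsilon> in at_right 0. norm (a \<epsilon> - b \<epsilon>) \<le> D * \<epsilon> ^ 0"
    using assms(2) unfolding negligible_nets_iff by blast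
  from C(2) D(2) eventually_unit_interval
  have "\<forall>\<^sub>F \<epsilon> in at_right 0. norm (b \<epsilon>) \<le> (C + D) * (1 / \<epsilon>) ^ N"
  proof eventually_elim
    case (elim \<epsilon>)
    have "1 \<le> (1 / \<epsilon>) ^ N" using elim by (intro one_le_power) auto
    then have "D * 1 \<le> D * (1 / \<epsilon>) ^ N" using D(1) by (intro mult_left_mono)
    moreover have "norm (b \<epsilon>) \<le> norm (a \<epsilon>) + norm (a \<epsilon> - b \<epsilon>)"
      by (metis norm_minus_commute norm_triangle_sub)
    ultimately show ?case using elim by (simp add: distrib_right)
  qed
  then have "b \<in> moderate_nets" using C(1) D(1) unfolding moderate_iff
    by (intro exI[of _ N] exI[of _ "C + D"]) auto
  with assms show ?thesis by (simp add: net_rel_def)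
qed

lemma moderate_one_plus:
  assumes "x \<in> moderate_nets"
  obtains m C where "0 \<le> C" "\<forall>\<^sub>F \<epsilon> in at_right 0. 1 + norm (x \<epsilon>) \<le> C * (1 / \<epsilon>) ^ m"
proof -
  obtain N C where C: "0 \<le> C" "\<forall>\<^sub>F \<epsilon> in at_right 0. norm (x \<epsilon>) \<le> C * (1 / \<epsilon>) ^ N"
    using assms unfolding moderate_iff by blast
  from C(2) eventually_unit_interval
  have "\<forall>\<^sub>F \<epsilon> in at_right 0. 1 + norm (x \<epsilon>) \<le> (C + 1) * (1 / \<epsilon>) ^ N"
  proof eventually_elim
    case (elim \<epsilon>)
    have "1 \<le> (1 / \<epsilon>) ^ N" using elim by (intro one_le_power) auto
    with elim show ?case unfolding distrib_right mult_1_left by linarith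
  qed
  with C(1) that[of "C + 1" N] show ?thesis by auto
qed

lemma power_cancel_one_over: "0 < (\<epsilon>::real) \<Longrightarrow> \<epsilon> ^ (q + m) * (1 / \<epsilon>) ^ m = \<epsilon> ^ q"
  by (simp add: power_add power_one_over)

lemma integral_negligible:
  fixes f :: "real \<Rightarrow> real ^ 'n \<Rightarrow> complex"
  assumes "\<And>\<epsilon>. 0 < \<epsilon> \<Longrightarrow> \<epsilon> \<le> 1 \<Longrightarrow> continuous_on UNIV (f \<epsilon>)"
    and "\<And>q. \<exists>C\<ge>0. \<forall>\<^sub>F \<epsilon> in at_right 0. \<forall>y. (1 + norm y) ^ (2 * CARD('n)) * norm (f \<epsilon> y) \<le> C * \<epsilon> ^ q"
  shows "(\<lambda>\<epsilon>. LINT y|lborel. f \<epsilon> y) \<in> negligible_nets"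
  unfolding negligible_nets_iff
proof
  fix q
  define I where "I = (LINT y|lborel. decay (y::real^'n))"
  have "0 \<le> I" unfolding I_def by (intro integral_nonneg_AE AE_I2) (simp add: decay_def prod_nonneg)
  obtain C where C: "0 \<le> C" "\<forall>\<^sub>F \<epsilon> in at_right 0. \<forall>y. (1 + norm y) ^ (2 * CARD('n)) * norm (f \<epsilon> y) \<le> C * \<epsilon> ^ q"
    using assms(2)[of q] by (elim exE conjE)
  from C(2) eventually_unit_interval
  have "\<forall>\<^sub>F \<epsilon> in at_right 0. norm (LINT y|lborel. f \<epsilon> y) \<le> (C * I) * \<epsilon> ^ q"
  proof eventually_elim
    case (elim \<epsilon>)
    have "norm (LINT y|lborel. f \<epsilon> y) \<le> (C * \<epsilon> ^ q) * I"
      unfolding I_def using elim by (intro norm_integral_le_decay assms(1)) auto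
    then show ?case by (simp add: mult_ac)
  qed
  with C(1) \<open>0 \<le> I\<close> show "\<exists>C\<ge>0. \<forall>\<^sub>F \<epsilon> in at_right 0. norm (LINT y|lborel. f \<epsilon> y) \<le> C * \<epsilon> ^ q"
    by (intro exI[of _ "C * I"]) auto
qed

section \<open>Point values and products: moderateness and independence of representatives\<close>

lemma point_value_negligible:
  assumes "w \<in> N_tau" "x \<in> moderate_nets"
  shows "(\<lambda>\<epsilon>. w \<epsilon> (x \<epsilon>)) \<in> negligible_nets"
  unfolding negligible_nets_iff
proof
  fix q
  obtain N where N: "\<forall>q. \<exists>C\<ge>0. \<forall>\<^sub>F \<epsilon> in at_right 0. \<forall>y. norm (w \<epsilon> y) \<le> C * \<epsilon> ^ q * (1 + norm y) ^ N"
    by (rule N_tau_growth[OF assms(1)])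
  obtain m D where D: "0 \<le> D" "\<forall>\<^sub>F \<epsilon> in at_right 0. 1 + norm (x \<epsilon>) \<le> D * (1 / \<epsilon>) ^ m"
    by (rule moderate_one_plus[OF assms(2)])
  \<comment> \<open>The m * N additional powers of \<epsilon> pay for (1 + |x|)^N, which is of order
    \<epsilon>^(-mN).\<close>
  obtain C where C: "0 \<le> C"
    "\<forall>\<^sub>F \<epsilon> in at_right 0. \<forall>y. norm (w \<epsilon> y) \<le> C * \<epsilon> ^ (q + m * N) * (1 + norm y) ^ N"
    using spec[OF N, of "q + m * N"] by (elim exE conjE)
  from C(2) D(2) eventually_unit_interval
  have "\<forall>\<^sub>F \<epsilon> in at_right 0. norm (w \<epsilon> (x \<epsilon>)) \<le> (C * D ^ N) * \<epsilon> ^ q"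
  proof eventually_elim
    case (elim \<epsilon>)
    have "norm (w \<epsilon> (x \<epsilon>)) \<le> C * \<epsilon> ^ (q + m * N) * (1 + norm (x \<epsilon>)) ^ N"
      by (rule spec[OF elim(1)])
    also have "\<dots> \<le> C * \<epsilon> ^ (q + m * N) * (D * (1 / \<epsilon>) ^ m) ^ N"
      using elim C(1) by (intro mult_left_mono power_mono) auto
    also have "\<dots> = C * D ^ N * (\<epsilon> ^ (q + m * N) * (1 / \<epsilon>) ^ (m * N))"
      by (simp only: power_mult_distrib power_mult[symmetric] mult_ac)
    also have "\<dots> = C * D ^ N * \<epsilon> ^ q"
      using elim by (simp only: power_cancel_one_over)
    finally show ?case .
  qed
  with C(1) D(1) show "\<exists>C\<ge>0. \<forall>\<^sub>F \<epsilon> in at_right 0. norm (w \<epsilon> (x \<epsilon>)) \<le> C * \<epsilon> ^ q"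
    by (intro exI[of _ "C * D ^ N"]) auto
qed

text \<open>The mean value inequality on the segment from \<open>x\<close> to \<open>x'\<close>,
  obtained as the case q = 1, h = 1 of the difference estimate with direction
  \<open>x' - x\<close>.\<close>

lemma norm_diff_le_growth:
  fixes u :: "real ^ 'n \<Rightarrow> complex"
  assumes "smooth u" "growth_bound N 1 B u" "0 \<le> B"
  shows "norm (u x' - u x) \<le> real CARD('n) * norm (x' - x) * (B * ((1 + norm x) ^ N * (1 + norm (x' - x)) ^ N))"
proof -
  define z where "z = x' - x"
  define G where "G k t = (dir_deriv z ^^ k) u (x + t *\<^sub>R z)" for k t
  have "norm ((fdiff 1 ^^ 1) (G 0) 0) \<le> 1 ^ 1 * (real CARD('n) * norm z * (B * ((1 + norm x) ^ N * (1 + norm z) ^ N)))"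
  proof (rule norm_fdiff_funpow_le_deriv[where T = 1])
    show "(G k has_vector_derivative G (Suc k) t) (at t)" for k t
      using has_vector_derivative_dir_deriv[OF smooth_dir_deriv_funpow[OF assms(1)], of k z x z t]
      by (simp add: G_def[abs_def])
    show "norm (G 1 t) \<le> real CARD('n) * norm z * (B * ((1 + norm x) ^ N * (1 + norm z) ^ N))"
      if "0 \<le> t" "t \<le> 1" for t
    proof -
      have "norm (iter_partial xs u (x + t *\<^sub>R z)) \<le> B * ((1 + norm x) ^ N * (1 + norm z) ^ N)" if "length xs = 1" for xs
      proof -
        have "norm (iter_partial xs u (x + t *\<^sub>R z)) \<le> B * (1 + norm (x + t *\<^sub>R z)) ^ N"
          using assms(2) that by (simp add: growth_bound_def)
        also have "\<dots> \<le> B * ((1 + norm x) ^ N * (1 + norm z) ^ N)"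
          using \<open>0 \<le> t\<close> \<open>t \<le> 1\<close> assms(3) by (intro mult_left_mono one_plus_norm_affine_le) auto
        finally show ?thesis .
      qed
      from norm_dir_deriv_funpow_le[OF assms(1) this, of 1 z] show ?thesis
        by (simp add: G_def)
    qed
  qed auto
  then show ?thesis by (simp add: fdiff_def G_def z_def)
qed

lemma point_value_cong:
  fixes u :: "real \<Rightarrow> real ^ 'n \<Rightarrow> complex"
  assumes "u \<in> E_tau_inf_inf" "(x, x') \<in> net_rel"
  shows "(\<lambda>\<epsilon>. u \<epsilon> (x' \<epsilon>) - u \<epsilon> (x \<epsilon>)) \<in> negligible_nets"
  unfolding negligible_nets_iff
proof
  fix q
  have sm: "\<And>\<epsilon>. 0 < \<epsilon> \<Longrightarrow> \<epsilon> \<le> 1 \<Longrightarrow> smooth (u \<epsilon>)"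
    using assms unfolding E_tau_inf_inf_def O_M_def by auto
  have x: "x \<in> moderate_nets" "(\<lambda>\<epsilon>. x' \<epsilon> - x \<epsilon>) \<in> negligible_nets"
    using assms(2) negligible_nets_minus_commute by (auto simp: net_rel_def)
  obtain N where N: "\<forall>j. \<exists>C\<ge>0. \<forall>\<^sub>F \<epsilon> in at_right 0. growth_bound N j (C * (1 / \<epsilon>) ^ N) (u \<epsilon>)"
    by (rule E_tau_inf_inf_growth[OF assms(1)])
  obtain B where B: "0 \<le> B" "\<forall>\<^sub>F \<epsilon> in at_right 0. growth_bound N 1 (B * (1 / \<epsilon>) ^ N) (u \<epsilon>)"
    using spec[OF N, of 1] by (elim exE conjE)
  obtain m D where D: "0 \<le> D" "\<forall>\<^sub>F \<epsilon> in at_right 0. 1 + norm (x \<epsilon>) \<le> D * (1 / \<epsilon>) ^ m"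
    by (rule moderate_one_plus[OF x(1)])
  \<comment> \<open>Negligibility is used twice: with exponent 0 to keep the factor (1 + |x' - x|)^N
    bounded, and below with a high exponent for the gain itself.\<close>
  obtain C0 where C0: "0 \<le> C0" "\<forall>\<^sub>F \<epsilon> in at_right 0. norm (x' \<epsilon> - x \<epsilon>) \<le> C0 * \<epsilon> ^ 0"
    using x(2)[unfolded negligible_nets_iff, THEN spec[of _ 0]] by (elim exE conjE)
  \<comment> \<open>The loss to be compensated: N from the derivative bound of \<open>u\<close>, and
    m * N from growth at the moving point \<open>x\<close>.\<close>
  define p where "p = N + m * N"
  obtain C where C: "0 \<le> C" "\<forall>\<^sub>F \<epsilon> in at_right 0. norm (x' \<epsilon> - x \<epsilon>) \<le> C * \<epsilon> ^ (q + p)"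
    using x(2)[unfolded negligible_nets_iff, THEN spec[of _ "q + p"]] by (elim exE conjE)
  define K where "K = real CARD('n) * C * B * D ^ N * (1 + C0) ^ N"
  from B(2) C(2) C0(2) D(2) eventually_unit_interval
  have "\<forall>\<^sub>F \<epsilon> in at_right 0. norm (u \<epsilon> (x' \<epsilon>) - u \<epsilon> (x \<epsilon>)) \<le> K * \<epsilon> ^ q"
  proof eventually_elim
    case (elim \<epsilon>)
    have "norm (u \<epsilon> (x' \<epsilon>) - u \<epsilon> (x \<epsilon>)) \<le> real CARD('n) * norm (x' \<epsilon> - x \<epsilon>) *
        ((B * (1 / \<epsilon>) ^ N) * ((1 + norm (x \<epsilon>)) ^ N * (1 + norm (x' \<epsilon> - x \<epsilon>)) ^ N))"
      using elim B(1) by (intro norm_diff_le_growth sm) auto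
    also have "\<dots> \<le> real CARD('n) * (C * \<epsilon> ^ (q + p)) * ((B * (1 / \<epsilon>) ^ N) * ((D * (1 / \<epsilon>) ^ m) ^ N * (1 + C0) ^ N))"
      using elim B(1) C(1) C0(1) D(1) by (intro mult_mono power_mono mult_nonneg_nonneg) auto
    also have "\<dots> = K * (\<epsilon> ^ (q + p) * (1 / \<epsilon>) ^ p)"
      by (simp only: K_def p_def power_mult_distrib power_mult[symmetric] power_add mult_ac)
    also have "\<dots> = K * \<epsilon> ^ q"
      using elim by (simp only: power_cancel_one_over)
    finally show ?case .
  qed
  moreover have "0 \<le> K" using B C C0 D by (simp add: K_def)
  ultimately show "\<exists>C\<ge>0. \<forall>\<^sub>F \<epsilon> in at_right 0. norm (u \<epsilon> (x' \<epsilon>) - u \<epsilon> (x \<epsilon>)) \<le> C * \<epsilon> ^ q"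
    by (intro exI[of _ K] conjI)
qed

lemma point_value_moderate:
  assumes "u \<in> E_tau" "x \<in> moderate_nets"
  shows "(\<lambda>\<epsilon>. u \<epsilon> (x \<epsilon>)) \<in> moderate_nets"
proof -
  obtain N C where C: "0 \<le> C" "\<forall>\<^sub>F \<epsilon> in at_right 0. \<forall>y. norm (u \<epsilon> y) \<le> C * (1 / \<epsilon>) ^ N * (1 + norm y) ^ N"
    by (rule E_tau_growth[OF assms(1)])
  obtain m D where D: "0 \<le> D" "\<forall>\<^sub>F \<epsilon> in at_right 0. 1 + norm (x \<epsilon>) \<le> D * (1 / \<epsilon>) ^ m"
    by (rule moderate_one_plus[OF assms(2)])
  from C(2) D(2) eventually_unit_interval
  have "\<forall>\<^sub>F \<epsilon> in at_right 0. norm (u \<epsilon> (x \<epsilon>)) \<le> (C * D ^ N) * (1 / \<epsilon>) ^ (N + m * N)"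
  proof eventually_elim
    case (elim \<epsilon>)
    have "norm (u \<epsilon> (x \<epsilon>)) \<le> C * (1 / \<epsilon>) ^ N * (1 + norm (x \<epsilon>)) ^ N"
      by (rule spec[OF elim(1)])
    also have "\<dots> \<le> C * (1 / \<epsilon>) ^ N * (D * (1 / \<epsilon>) ^ m) ^ N"
      using elim C(1) by (intro mult_left_mono power_mono) auto
    also have "\<dots> = (C * D ^ N) * (1 / \<epsilon>) ^ (N + m * N)"
      by (simp only: power_mult_distrib power_mult[symmetric] power_add mult_ac)
    finally show ?case .
  qed
  with C(1) D(1) show ?thesis
    unfolding moderate_iff by (intro exI[of _ "N + m * N"] exI[of _ "C * D ^ N"]) auto
qed

text \<open>\<open>S_rel\<close> relates members of \<open>E_S\<close> only, so a product outside
  \<open>E_S\<close> would contribute an empty class. This membership guarantees that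
  \<open>GS_mult\<close> has an element when the second factor has a regular representative.\<close>

lemma E_S_mult:
  assumes "v \<in> E_S" "u \<in> E_tau_inf_inf"
  shows "(\<lambda>\<epsilon> y. v \<epsilon> y * u \<epsilon> y) \<in> E_S"
proof -
  have v: "\<And>\<epsilon>. 0 < \<epsilon> \<Longrightarrow> \<epsilon> \<le> 1 \<Longrightarrow> v \<epsilon> \<in> schwartz_space" and u: "\<And>\<epsilon>. 0 < \<epsilon> \<Longrightarrow> \<epsilon> \<le> 1 \<Longrightarrow> u \<epsilon> \<in> O_M"
    using assms by (auto simp: E_S_def E_tau_inf_inf_def)
  obtain N where N: "\<forall>j. \<exists>C\<ge>0. \<forall>\<^sub>F \<epsilon> in at_right 0. growth_bound N j (C * (1 / \<epsilon>) ^ N) (u \<epsilon>)"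
    by (rule E_tau_inf_inf_growth[OF assms(2)])
  show ?thesis
    unfolding E_S_iff
  proof (intro conjI ballI allI)
    fix \<epsilon> :: real assume "\<epsilon> \<in> {0<..1}"
    then show "(\<lambda>y. v \<epsilon> y * u \<epsilon> y) \<in> schwartz_space"
      by (intro schwartz_O_M_mult v u) auto
  next
    fix j
    obtain B where B: "0 \<le> B" "\<forall>\<^sub>F \<epsilon> in at_right 0. growth_bound N j (B * (1 / \<epsilon>) ^ N) (u \<epsilon>)"
      using spec[OF N, of j] by (elim exE conjE)
    obtain m A where A: "0 \<le> A" "\<forall>\<^sub>F \<epsilon> in at_right 0. schwartz_bound (j + N) (A * (1 / \<epsilon>) ^ m) (v \<epsilon>)"
      using assms(1) unfolding E_S_iff by blast
    from A(2) B(2) eventually_unit_interval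
    have "\<forall>\<^sub>F \<epsilon> in at_right 0. schwartz_bound j (2 ^ j * A * B * (1 / \<epsilon>) ^ (m + N)) (\<lambda>y. v \<epsilon> y * u \<epsilon> y)"
    proof eventually_elim
      case (elim \<epsilon>)
      have "schwartz_bound j (2 ^ j * (A * (1 / \<epsilon>) ^ m) * (B * (1 / \<epsilon>) ^ N)) (\<lambda>y. v \<epsilon> y * u \<epsilon> y)"
        using elim A(1) B(1) v[of \<epsilon>] u[of \<epsilon>]
        by (intro schwartz_bound_mult) (auto simp: schwartz_space_def O_M_def)
      then show ?case by (simp add: power_add mult_ac)
    qed
    with A(1) B(1) show "\<exists>N C. 0 \<le> C \<and>
        (\<forall>\<^sub>F \<epsilon> in at_right 0. schwartz_bound j (C * (1 / \<epsilon>) ^ N) (\<lambda>y. v \<epsilon> y * u \<epsilon> y))"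
      by (intro exI[of _ "m + N"] exI[of _ "2 ^ j * A * B"]) auto
  qed
qed

section \<open>Approximate delta functions\<close>

definition cut_off :: "real \<Rightarrow> nat" where
  "cut_off \<epsilon> = nat \<lfloor>log 2 (1 / \<epsilon>)\<rfloor>"

text \<open>Both bounds come from 2^M \<le> 1/\<epsilon>: the first keeps the binomial weights
  moderate, and the second follows by M \<le> 2^M and keeps the largest width M\<epsilon> at most
  1.\<close>

lemma cut_off:
  assumes "0 < \<epsilon>" "\<epsilon> \<le> 1"
  shows "2 ^ cut_off \<epsilon> \<le> 1 / \<epsilon>" "real (cut_off \<epsilon>) * \<epsilon> \<le> 1"
proof -
  have "0 \<le> log 2 (1 / \<epsilon>)" using assms by (simp add: zero_le_log_cancel_iff)
  then have "real (cut_off \<epsilon>) \<le> log 2 (1 / \<epsilon>)"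
    by (simp add: cut_off_def)
  then have "2 powr real (cut_off \<epsilon>) \<le> 2 powr log 2 (1 / \<epsilon>)"
    by (intro powr_mono) auto
  then show *: "2 ^ cut_off \<epsilon> \<le> 1 / \<epsilon>"
    using assms by (simp add: powr_realpow)
  have "real (cut_off \<epsilon>) \<le> 2 ^ cut_off \<epsilon>"
    by (rule less_imp_le[OF of_nat_less_two_power])
  then have "real (cut_off \<epsilon>) \<le> 1 / \<epsilon>" using * by linarith
  then show "real (cut_off \<epsilon>) * \<epsilon> \<le> 1"
    using assms by (simp add: pos_le_divide_eq)
qed

lemma eventually_cut_off_ge: "\<forall>\<^sub>F \<epsilon> in at_right 0. q \<le> cut_off \<epsilon>"
proof -
  have "\<forall>\<^sub>F \<epsilon> in at_right (0::real). 0 < \<epsilon> \<and> \<epsilon> < 1 / 2 ^ q"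
    by (auto simp: eventually_at_right_field intro: exI[of _ "1 / 2 ^ q"])
  then show ?thesis
  proof eventually_elim
    case (elim \<epsilon>)
    then have "2 ^ q \<le> 1 / \<epsilon>" by (simp add: field_simps)
    then have "log 2 (2 ^ q) \<le> log 2 (1 / \<epsilon>)"
      using elim by (intro log_mono) auto
    then have "real q \<le> log 2 (1 / \<epsilon>)" by (simp add: log_nat_power)
    then show ?case unfolding cut_off_def by (rule le_nat_floor)
  qed
qed

definition delta_net :: "(real ^ 'n \<Rightarrow> complex) \<Rightarrow> (real \<Rightarrow> real ^ 'n) \<Rightarrow> real \<Rightarrow> real ^ 'n \<Rightarrow> complex" where
  "delta_net \<rho> x \<epsilon> = mollifier \<rho> (cut_off \<epsilon>) \<epsilon> (x \<epsilon>)"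

lemma delta_net_E_S:
  fixes \<rho> :: "real ^ 'n \<Rightarrow> complex"
  assumes "\<rho> \<in> schwartz_space" "x \<in> moderate_nets"
  shows "delta_net \<rho> x \<in> E_S"
  unfolding E_S_iff
proof (intro conjI ballI allI)
  fix \<epsilon> :: real assume "\<epsilon> \<in> {0<..1}"
  then show "delta_net \<rho> x \<epsilon> \<in> schwartz_space"
    unfolding delta_net_def by (intro mollifier_schwartz assms cut_off) auto
next
  fix j
  have sm: "smooth \<rho>" using assms(1) by (simp add: schwartz_space_def)
  obtain A where A: "0 \<le> A" "schwartz_bound j A \<rho>"
    using assms(1) unfolding schwartz_space_iff by blast
  obtain m D where D: "0 \<le> D" "\<forall>\<^sub>F \<epsilon> in at_right 0. 1 + norm (x \<epsilon>) \<le> D * (1 / \<epsilon>) ^ m"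
    by (rule moderate_one_plus[OF assms(2)])
  \<comment> \<open>The exponent collects 1 from the binomial weights, m * j from the weight at the
    centre, and n + j from rescaling.\<close>
  define p where "p = 1 + (m * j + (CARD('n) + j))"
  from D(2) eventually_unit_interval
  have "\<forall>\<^sub>F \<epsilon> in at_right 0. schwartz_bound j (A * D ^ j * (1 / \<epsilon>) ^ p) (delta_net \<rho> x \<epsilon>)"
  proof eventually_elim
    case (elim \<epsilon>)
    have "2 ^ cut_off \<epsilon> * (A * (1 + norm (x \<epsilon>)) ^ j * (1 / \<epsilon>) ^ (CARD('n) + j)) \<le>
        (1 / \<epsilon>) * (A * (D * (1 / \<epsilon>) ^ m) ^ j * (1 / \<epsilon>) ^ (CARD('n) + j))"
      using elim A(1) D(1)
      by (intro mult_mono power_mono cut_off mult_nonneg_nonneg) auto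
    also have "\<dots> = A * D ^ j * (1 / \<epsilon>) ^ p"
      by (simp only: p_def power_mult_distrib power_mult[symmetric] power_add power_one_right mult_ac)
    finally have "2 ^ cut_off \<epsilon> * (A * (1 + norm (x \<epsilon>)) ^ j * (1 / \<epsilon>) ^ (CARD('n) + j)) \<le> A * D ^ j * (1 / \<epsilon>) ^ p" .
    moreover have "schwartz_bound j (2 ^ cut_off \<epsilon> * (A * (1 + norm (x \<epsilon>)) ^ j * (1 / \<epsilon>) ^ (CARD('n) + j)))
        (delta_net \<rho> x \<epsilon>)"
      unfolding delta_net_def using elim by (intro schwartz_bound_mollifier sm A cut_off) auto
    ultimately show ?case
      unfolding schwartz_bound_def using order_trans by blast
  qed
  then show "\<exists>N C. 0 \<le> C \<and> (\<forall>\<^sub>F \<epsilon> in at_right 0. schwartz_bound j (C * (1 / \<epsilon>) ^ N) (delta_net \<rho> x \<epsilon>))"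
    using A(1) D(1) by (intro exI[of _ p] exI[of _ "A * D ^ j"] conjI) auto
qed

lemma delta_net_sifting:
  fixes \<rho> :: "real ^ 'n \<Rightarrow> complex"
  assumes "\<rho> \<in> schwartz_space" "(LINT y|lborel. \<rho> y) = 1" "x \<in> moderate_nets" "u \<in> E_tau_inf_inf"
  shows "(\<lambda>\<epsilon>. (LINT y|lborel. delta_net \<rho> x \<epsilon> y * u \<epsilon> y) - u \<epsilon> (x \<epsilon>)) \<in> negligible_nets"
  unfolding negligible_nets_iff
proof
  fix q
  have sm: "smooth \<rho>" "\<And>\<epsilon>. 0 < \<epsilon> \<Longrightarrow> \<epsilon> \<le> 1 \<Longrightarrow> smooth (u \<epsilon>)"
    using assms by (auto simp: schwartz_space_def E_tau_inf_inf_def O_M_def)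
  obtain N where N: "\<forall>j. \<exists>C\<ge>0. \<forall>\<^sub>F \<epsilon> in at_right 0. growth_bound N j (C * (1 / \<epsilon>) ^ N) (u \<epsilon>)"
    by (rule E_tau_inf_inf_growth[OF assms(4)])
  obtain m D where D: "0 \<le> D" "\<forall>\<^sub>F \<epsilon> in at_right 0. 1 + norm (x \<epsilon>) \<le> D * (1 / \<epsilon>) ^ m"
    by (rule moderate_one_plus[OF assms(3)])
  define p where "p = 1 + (N + m * N)"
  obtain B where B: "0 \<le> B" "\<forall>\<^sub>F \<epsilon> in at_right 0. growth_bound N (q + p) (B * (1 / \<epsilon>) ^ N) (u \<epsilon>)"
    using spec[OF N, of "q + p"] by (elim exE conjE)
  obtain A where A: "0 \<le> A" "schwartz_bound (2 * CARD('n) + (q + p) + N) A \<rho>"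
    using assms(1) unfolding schwartz_space_iff by blast
  define I where "I = (LINT y|lborel. decay (y::real^'n))"
  have I: "0 \<le> I" unfolding I_def by (intro integral_nonneg_AE AE_I2) (simp add: decay_def prod_nonneg)
  define K where "K = real CARD('n) ^ (q + p) * B * D ^ N * A * I"
  from B(2) D(2) eventually_unit_interval eventually_cut_off_ge[of "q + p"]
  have "\<forall>\<^sub>F \<epsilon> in at_right 0. norm ((LINT y|lborel. delta_net \<rho> x \<epsilon> y * u \<epsilon> y) - u \<epsilon> (x \<epsilon>)) \<le> K * \<epsilon> ^ q"
  proof eventually_elim
    case (elim \<epsilon>)
    have "norm ((LINT y|lborel. delta_net \<rho> x \<epsilon> y * u \<epsilon> y) - u \<epsilon> (x \<epsilon>)) \<le>
        (2 ^ cut_off \<epsilon> * \<epsilon> ^ (q + p) * (real CARD('n) ^ (q + p) * (B * (1 / \<epsilon>) ^ N) * (1 + norm (x \<epsilon>)) ^ N) * A) * I"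
      unfolding delta_net_def I_def
      using elim B(1) by (intro mollifier_error sm assms(2) A(2) cut_off) auto
    also have "\<dots> \<le> ((1 / \<epsilon>) * \<epsilon> ^ (q + p) * (real CARD('n) ^ (q + p) * (B * (1 / \<epsilon>) ^ N) * (D * (1 / \<epsilon>) ^ m) ^ N) * A) * I"
      using elim A(1) B(1) D(1) I
      by (intro mult_right_mono mult_mono power_mono cut_off mult_nonneg_nonneg) auto
    also have "\<dots> = K * (\<epsilon> ^ (q + p) * (1 / \<epsilon>) ^ p)"
      unfolding K_def power_mult_distrib power_mult[symmetric]
      by (simp only: p_def power_add[of "1 / \<epsilon>"] power_one_right mult_ac)
    also have "\<dots> = K * \<epsilon> ^ q"
      using elim by (simp only: power_cancel_one_over)
    finally show ?case .
  qed
  moreover have "0 \<le> K" using A B D I by (simp add: K_def)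
  ultimately show "\<exists>C\<ge>0. \<forall>\<^sub>F \<epsilon> in at_right 0.
      norm ((LINT y|lborel. delta_net \<rho> x \<epsilon> y * u \<epsilon> y) - u \<epsilon> (x \<epsilon>)) \<le> C * \<epsilon> ^ q"
    by (intro exI[of _ K] conjI)
qed

section \<open>Integrals of products\<close>

lemma weighted_product_le:
  fixes y :: "'a::real_normed_vector" and a b :: complex
  assumes "(1 + norm y) ^ (k + N) * norm a \<le> A" "norm b \<le> B * (1 + norm y) ^ N" "0 \<le> B"
  shows "(1 + norm y) ^ k * norm (a * b) \<le> A * B"
proof -
  have "(1 + norm y) ^ k * norm (a * b) \<le> (1 + norm y) ^ k * (norm a * (B * (1 + norm y) ^ N))"
    unfolding norm_mult using assms(2) by (intro mult_left_mono) auto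
  also have "\<dots> = ((1 + norm y) ^ (k + N) * norm a) * B"
    by (simp only: power_add mult_ac)
  also have "\<dots> \<le> A * B" using assms(1,3) by (rule mult_right_mono)
  finally show ?thesis .
qed

lemma E_S_D: "v \<in> E_S \<Longrightarrow> 0 < \<epsilon> \<Longrightarrow> \<epsilon> \<le> 1 \<Longrightarrow> v \<epsilon> \<in> schwartz_space"
  and N_S_D: "v \<in> N_S \<Longrightarrow> 0 < \<epsilon> \<Longrightarrow> \<epsilon> \<le> 1 \<Longrightarrow> v \<epsilon> \<in> schwartz_space"
  and E_tau_D: "u \<in> E_tau \<Longrightarrow> 0 < \<epsilon> \<Longrightarrow> \<epsilon> \<le> 1 \<Longrightarrow> u \<epsilon> \<in> O_M"
  and N_tau_D: "u \<in> N_tau \<Longrightarrow> 0 < \<epsilon> \<Longrightarrow> \<epsilon> \<le> 1 \<Longrightarrow> u \<epsilon> \<in> O_M"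
  by (auto simp: E_S_def N_S_def E_tau_def N_tau_def)

lemma continuous_on_schwartz_mult:
  "f \<in> schwartz_space \<Longrightarrow> g \<in> O_M \<Longrightarrow> continuous_on UNIV (\<lambda>y. f y * g y)"
  by (intro smooth_continuous_on smooth_mult) (auto simp: schwartz_space_def O_M_def)

lemma integral_N_S_negligible:
  fixes w :: "real \<Rightarrow> real ^ 'n \<Rightarrow> complex"
  assumes "w \<in> N_S"
  shows "(\<lambda>\<epsilon>. LINT y|lborel. w \<epsilon> y) \<in> negligible_nets"
proof (rule integral_negligible)
  show "continuous_on UNIV (w \<epsilon>)" if "0 < \<epsilon>" "\<epsilon> \<le> 1" for \<epsilon>
    using N_S_D[OF assms that] by (intro smooth_continuous_on) (simp add: schwartz_space_def)
  fix q
  obtain C where C: "0 \<le> C" "\<forall>\<^sub>F \<epsilon> in at_right 0. schwartz_bound (2 * CARD('n)) (C * \<epsilon> ^ q) (w \<epsilon>)"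
    using assms unfolding N_S_iff by blast
  from C(2) have "\<forall>\<^sub>F \<epsilon> in at_right 0. \<forall>y. (1 + norm y) ^ (2 * CARD('n)) * norm (w \<epsilon> y) \<le> C * \<epsilon> ^ q"
    by eventually_elim (blast intro: schwartz_bound_value)
  with C(1) show "\<exists>C\<ge>0. \<forall>\<^sub>F \<epsilon> in at_right 0. \<forall>y. (1 + norm y) ^ (2 * CARD('n)) * norm (w \<epsilon> y) \<le> C * \<epsilon> ^ q"
    by (intro exI[of _ C] conjI)
qed

lemma integral_N_S_mult_negligible:
  fixes v :: "real \<Rightarrow> real ^ 'n \<Rightarrow> complex"
  assumes "v \<in> N_S" "u \<in> E_tau"
  shows "(\<lambda>\<epsilon>. LINT y|lborel. v \<epsilon> y * u \<epsilon> y) \<in> negligible_nets"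
proof (rule integral_negligible)
  show "continuous_on UNIV (\<lambda>y. v \<epsilon> y * u \<epsilon> y)" if "0 < \<epsilon>" "\<epsilon> \<le> 1" for \<epsilon>
    using that assms by (intro continuous_on_schwartz_mult N_S_D E_tau_D)
  fix q
  obtain N B where B: "0 \<le> B" "\<forall>\<^sub>F \<epsilon> in at_right 0. \<forall>y. norm (u \<epsilon> y) \<le> B * (1 / \<epsilon>) ^ N * (1 + norm y) ^ N"
    by (rule E_tau_growth[OF assms(2)])
  obtain C where C: "0 \<le> C"
    "\<forall>\<^sub>F \<epsilon> in at_right 0. schwartz_bound (2 * CARD('n) + N) (C * \<epsilon> ^ (q + N)) (v \<epsilon>)"
    using assms(1) unfolding N_S_iff by blast
  from B(2) C(2) eventually_unit_interval
  have "\<forall>\<^sub>F \<epsilon> in at_right 0. \<forall>y. (1 + norm y) ^ (2 * CARD('n)) * norm (v \<epsilon> y * u \<epsilon> y) \<le> (C * B) * \<epsilon> ^ q"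
  proof eventually_elim
    case (elim \<epsilon>)
    have "C * \<epsilon> ^ (q + N) * (B * (1 / \<epsilon>) ^ N) = (C * B) * (\<epsilon> ^ (q + N) * (1 / \<epsilon>) ^ N)"
      by (simp only: mult_ac)
    also have "\<dots> = (C * B) * \<epsilon> ^ q" using elim by (simp only: power_cancel_one_over)
    finally have eq: "C * \<epsilon> ^ (q + N) * (B * (1 / \<epsilon>) ^ N) = (C * B) * \<epsilon> ^ q" .
    have "0 \<le> B * (1 / \<epsilon>) ^ N" using B(1) elim by simp
    then show ?case
      unfolding eq[symmetric]
      by (intro allI weighted_product_le[OF schwartz_bound_value[OF elim(2)] spec[OF elim(1)]])
  qed
  with C(1) B(1) show "\<exists>C\<ge>0. \<forall>\<^sub>F \<epsilon> in at_right 0. \<forall>y. (1 + norm y) ^ (2 * CARD('n)) * norm (v \<epsilon> y * u \<epsilon> y) \<le> C * \<epsilon> ^ q"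
    by (intro exI[of _ "C * B"] conjI mult_nonneg_nonneg)
qed

lemma integral_mult_N_tau_negligible:
  fixes v :: "real \<Rightarrow> real ^ 'n \<Rightarrow> complex"
  assumes "v \<in> E_S" "u \<in> N_tau"
  shows "(\<lambda>\<epsilon>. LINT y|lborel. v \<epsilon> y * u \<epsilon> y) \<in> negligible_nets"
proof (rule integral_negligible)
  show "continuous_on UNIV (\<lambda>y. v \<epsilon> y * u \<epsilon> y)" if "0 < \<epsilon>" "\<epsilon> \<le> 1" for \<epsilon>
    using that assms by (intro continuous_on_schwartz_mult E_S_D N_tau_D)
  fix q
  obtain N where N: "\<forall>q. \<exists>C\<ge>0. \<forall>\<^sub>F \<epsilon> in at_right 0. \<forall>y. norm (u \<epsilon> y) \<le> C * \<epsilon> ^ q * (1 + norm y) ^ N"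
    by (rule N_tau_growth[OF assms(2)])
  obtain m A where A: "0 \<le> A"
    "\<forall>\<^sub>F \<epsilon> in at_right 0. schwartz_bound (2 * CARD('n) + N) (A * (1 / \<epsilon>) ^ m) (v \<epsilon>)"
    using assms(1) unfolding E_S_iff by blast
  obtain B where B: "0 \<le> B" "\<forall>\<^sub>F \<epsilon> in at_right 0. \<forall>y. norm (u \<epsilon> y) \<le> B * \<epsilon> ^ (q + m) * (1 + norm y) ^ N"
    using spec[OF N, of "q + m"] by (elim exE conjE)
  from A(2) B(2) eventually_unit_interval
  have "\<forall>\<^sub>F \<epsilon> in at_right 0. \<forall>y. (1 + norm y) ^ (2 * CARD('n)) * norm (v \<epsilon> y * u \<epsilon> y) \<le> (A * B) * \<epsilon> ^ q"
  proof eventually_elim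
    case (elim \<epsilon>)
    have "A * (1 / \<epsilon>) ^ m * (B * \<epsilon> ^ (q + m)) = (A * B) * (\<epsilon> ^ (q + m) * (1 / \<epsilon>) ^ m)"
      by (simp only: mult_ac)
    also have "\<dots> = (A * B) * \<epsilon> ^ q" using elim by (simp only: power_cancel_one_over)
    finally have eq: "A * (1 / \<epsilon>) ^ m * (B * \<epsilon> ^ (q + m)) = (A * B) * \<epsilon> ^ q" .
    have "0 \<le> B * \<epsilon> ^ (q + m)" using B(1) elim by simp
    then show ?case
      unfolding eq[symmetric]
      by (intro allI weighted_product_le[OF schwartz_bound_value[OF elim(1)] spec[OF elim(2)]])
  qed
  with A(1) B(1) show "\<exists>C\<ge>0. \<forall>\<^sub>F \<epsilon> in at_right 0. \<forall>y. (1 + norm y) ^ (2 * CARD('n)) * norm (v \<epsilon> y * u \<epsilon> y) \<le> C * \<epsilon> ^ q"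
    by (intro exI[of _ "A * B"] conjI mult_nonneg_nonneg)
qed

text \<open>Linearity of the integral needs integrability, which is known for \<epsilon> in (0,1]
  only; the two nets are therefore compared for small \<epsilon>.\<close>

lemma integral_diff_negligible:
  fixes f g :: "real \<Rightarrow> real ^ 'n \<Rightarrow> complex"
  assumes "\<And>\<epsilon>. 0 < \<epsilon> \<Longrightarrow> \<epsilon> \<le> 1 \<Longrightarrow> f \<epsilon> \<in> schwartz_space"
    and "\<And>\<epsilon>. 0 < \<epsilon> \<Longrightarrow> \<epsilon> \<le> 1 \<Longrightarrow> g \<epsilon> \<in> schwartz_space"
    and "(\<lambda>\<epsilon>. LINT y|lborel. f \<epsilon> y - g \<epsilon> y) \<in> negligible_nets"
  shows "(\<lambda>\<epsilon>. (LINT y|lborel. f \<epsilon> y) - (LINT y|lborel. g \<epsilon> y)) \<in> negligible_nets"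
proof (rule negligible_cong[OF assms(3)])
  show "\<forall>\<^sub>F \<epsilon> in at_right 0. (LINT y|lborel. f \<epsilon> y) - (LINT y|lborel. g \<epsilon> y) = (LINT y|lborel. f \<epsilon> y - g \<epsilon> y)"
    by (rule eventually_mono[OF eventually_unit_interval])
       (simp add: Bochner_Integration.integral_diff schwartz_integrable assms(1,2))
qed

lemma zero_N_S: "(\<lambda>\<epsilon> x. 0) \<in> N_S"
  unfolding N_S_iff schwartz_space_iff
  by (auto intro!: smooth_const exI[of _ 0] simp: schwartz_bound_0)

section \<open>Passage from nets to classes\<close>

theorem proposition2p4:
  fixes X :: "(real \<Rightarrow> real ^ 'n) set"
  assumes "X \<in> Rn_tilde"
  shows "\<exists>V\<in>G_S. \<forall>U\<in>G_tau_inf_inf.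
           point_value U X \<in> C_tilde \<and> point_value U X = GS_integral (GS_mult V U)"
proof -
  obtain x where x: "x \<in> moderate_nets" "X = net_rel `` {x}"
    using assms unfolding Rn_tilde_def by (elim quotientE)
  obtain \<rho> :: "real ^ 'n \<Rightarrow> complex" where \<rho>: "\<rho> \<in> schwartz_space" "(LINT y|lborel. \<rho> y) = 1"
    using ex_normalized_schwartz by (elim exE conjE)
  define v where "v = delta_net \<rho> x"
  have v: "v \<in> E_S" unfolding v_def by (rule delta_net_E_S[OF \<rho>(1) x(1)])
  define V where "V = S_rel `` {v}"
  have "V \<in> G_S" unfolding G_S_def V_def by (rule quotientI[OF v])
  moreover have "point_value U X \<in> C_tilde \<and> point_value U X = GS_integral (GS_mult V U)"
    if U: "U \<in> G_tau_inf_inf" for U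
  proof -
    obtain u where u: "u \<in> U" "u \<in> E_tau_inf_inf" and "U \<in> G_tau"
      using U unfolding G_tau_inf_inf_def by blast
    then obtain u0 where u0: "u0 \<in> E_tau" "U = tau_rel `` {u0}"
      unfolding G_tau_def by (elim quotientE)
    have UD: "u' \<in> E_tau" "(\<lambda>\<epsilon> y. u0 \<epsilon> y - u' \<epsilon> y) \<in> N_tau" if "u' \<in> U" for u'
      using that unfolding u0(2) tau_rel_def by auto
    have XD: "x' \<in> moderate_nets" "(x, x') \<in> net_rel" if "x' \<in> X" for x'
      using that unfolding x(2) net_rel_def by auto
    \<comment> \<open>Both sides of the equation will turn out to be the class of this net, formed
      from the regular representative \<open>u\<close> and the centre \<open>x\<close> of the
      approximate delta.\<close>
    define a where "a = (\<lambda>\<epsilon>. u \<epsilon> (x \<epsilon>))"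
    have a: "a \<in> moderate_nets"
      unfolding a_def by (rule point_value_moderate[OF UD(1)[OF u(1)] x(1)])
    \<comment> \<open>The point is moved from \<open>x\<close> to \<open>x'\<close> inside the
      regular \<open>u\<close>, where derivatives are controlled; afterwards \<open>u\<close> is
      exchanged for \<open>u'\<close> through \<open>u0\<close>, the representative to which
      membership in \<open>U\<close> refers.\<close>
    have point: "(a, \<lambda>\<epsilon>. u' \<epsilon> (x' \<epsilon>)) \<in> net_rel" if "u' \<in> U" "x' \<in> X" for u' x'
    proof (rule net_relI[OF a])
      have 1: "(\<lambda>\<epsilon>. a \<epsilon> - u \<epsilon> (x' \<epsilon>)) \<in> negligible_nets"
        unfolding a_def
        by (rule negligible_nets_minus_commute[THEN iffD1]) (rule point_value_cong[OF u(2) XD(2)[OF that(2)]])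
      have 2: "(\<lambda>\<epsilon>. u \<epsilon> (x' \<epsilon>) - u0 \<epsilon> (x' \<epsilon>)) \<in> negligible_nets"
        by (rule negligible_nets_minus_commute[THEN iffD1])
           (rule point_value_negligible[OF UD(2)[OF u(1)] XD(1)[OF that(2)]])
      have 3: "(\<lambda>\<epsilon>. u0 \<epsilon> (x' \<epsilon>) - u' \<epsilon> (x' \<epsilon>)) \<in> negligible_nets"
        by (rule point_value_negligible[OF UD(2)[OF that(1)] XD(1)[OF that(2)]])
      show "(\<lambda>\<epsilon>. a \<epsilon> - u' \<epsilon> (x' \<epsilon>)) \<in> negligible_nets"
        by (rule negligible_nets_diff_trans[OF 1 negligible_nets_diff_trans[OF 2 3]])
    qed
    have "x \<in> X"
      unfolding x(2) using x(1) zero_negligible by (simp add: net_rel_def)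
    have pv: "point_value U X = net_rel `` {a}"
    proof -
      have "net_rel `` {\<lambda>\<epsilon>. u' \<epsilon> (x' \<epsilon>)} = net_rel `` {a}" if "u' \<in> U" "x' \<in> X" for u' x'
        by (rule equiv_class_eq[OF equiv_net_rel point[OF that], symmetric])
      then show ?thesis
        unfolding point_value_def using u(1) \<open>x \<in> X\<close> by auto
    qed
    \<comment> \<open>Starting from the sifting estimate, one ingredient changes at a time: u to u0,
      u0 to u', v to v', and finally the product v'u' to an equivalent net w. Each change alters the
      integral negligibly.\<close>
    have int: "(a, \<lambda>\<epsilon>. LINT y|lborel. w \<epsilon> y) \<in> net_rel"
      if "v' \<in> V" "u' \<in> U" "(\<lambda>\<epsilon> y. v' \<epsilon> y * u' \<epsilon> y, w) \<in> S_rel" for v' u' w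
    proof (rule net_relI[OF a])
      have v': "v' \<in> E_S" "(\<lambda>\<epsilon> y. v \<epsilon> y - v' \<epsilon> y) \<in> N_S"
        using that(1) unfolding V_def S_rel_def by auto
      have w: "w \<in> E_S" "(\<lambda>\<epsilon> y. v' \<epsilon> y * u' \<epsilon> y - w \<epsilon> y) \<in> N_S"
        using that(3) unfolding S_rel_def by auto
      note E = E_S_D E_tau_D schwartz_O_M_mult
      note UE = UD(1)[OF that(2)] UD(1)[OF u(1)]
      have 1: "(\<lambda>\<epsilon>. a \<epsilon> - (LINT y|lborel. v \<epsilon> y * u \<epsilon> y)) \<in> negligible_nets"
        unfolding a_def v_def
        by (rule negligible_nets_minus_commute[THEN iffD1]) (rule delta_net_sifting[OF \<rho> x(1) u(2)])
      have 2: "(\<lambda>\<epsilon>. (LINT y|lborel. v \<epsilon> y * u \<epsilon> y) - (LINT y|lborel. v \<epsilon> y * u0 \<epsilon> y)) \<in> negligible_nets"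
      proof (rule negligible_nets_minus_commute[THEN iffD1], rule integral_diff_negligible)
        show "(\<lambda>\<epsilon>. LINT y|lborel. v \<epsilon> y * u0 \<epsilon> y - v \<epsilon> y * u \<epsilon> y) \<in> negligible_nets"
          using integral_mult_N_tau_negligible[OF v UD(2)[OF u(1)]] by (simp only: right_diff_distrib)
      qed (auto intro: E v u0 UE)
      have 3: "(\<lambda>\<epsilon>. (LINT y|lborel. v \<epsilon> y * u0 \<epsilon> y) - (LINT y|lborel. v \<epsilon> y * u' \<epsilon> y)) \<in> negligible_nets"
      proof (rule integral_diff_negligible)
        show "(\<lambda>\<epsilon>. LINT y|lborel. v \<epsilon> y * u0 \<epsilon> y - v \<epsilon> y * u' \<epsilon> y) \<in> negligible_nets"
          using integral_mult_N_tau_negligible[OF v UD(2)[OF that(2)]] by (simp only: right_diff_distrib)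
      qed (auto intro: E v u0 UE)
      have 4: "(\<lambda>\<epsilon>. (LINT y|lborel. v \<epsilon> y * u' \<epsilon> y) - (LINT y|lborel. v' \<epsilon> y * u' \<epsilon> y)) \<in> negligible_nets"
      proof (rule integral_diff_negligible)
        show "(\<lambda>\<epsilon>. LINT y|lborel. v \<epsilon> y * u' \<epsilon> y - v' \<epsilon> y * u' \<epsilon> y) \<in> negligible_nets"
          using integral_N_S_mult_negligible[OF v'(2) UE(1)] by (simp only: left_diff_distrib)
      qed (auto intro: E v v' UE)
      have 5: "(\<lambda>\<epsilon>. (LINT y|lborel. v' \<epsilon> y * u' \<epsilon> y) - (LINT y|lborel. w \<epsilon> y)) \<in> negligible_nets"
        by (rule integral_diff_negligible[OF _ _ integral_N_S_negligible[OF w(2)]])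
           (auto intro: E v' w UE)
      show "(\<lambda>\<epsilon>. a \<epsilon> - (LINT y|lborel. w \<epsilon> y)) \<in> negligible_nets"
        by (rule negligible_nets_diff_trans[OF 1 negligible_nets_diff_trans[OF 2
              negligible_nets_diff_trans[OF 3 negligible_nets_diff_trans[OF 4 5]]]])
    qed
    have "v \<in> V"
      unfolding V_def using v zero_N_S by (simp add: S_rel_def)
    have vu: "(\<lambda>\<epsilon> y. v \<epsilon> y * u \<epsilon> y, \<lambda>\<epsilon> y. v \<epsilon> y * u \<epsilon> y) \<in> S_rel"
      using E_S_mult[OF v u(2)] zero_N_S by (simp add: S_rel_def)
    have "GS_integral (GS_mult V U) = net_rel `` {a}"
    proof -
      have eq: "net_rel `` {\<lambda>\<epsilon>. LINT y|lborel. w \<epsilon> y} = net_rel `` {a}" if "w \<in> GS_mult V U" for w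
      proof -
        obtain v' u' where "v' \<in> V" "u' \<in> U" "(\<lambda>\<epsilon> y. v' \<epsilon> y * u' \<epsilon> y, w) \<in> S_rel"
          using \<open>w \<in> GS_mult V U\<close> unfolding GS_mult_def by auto
        then show ?thesis by (intro equiv_class_eq[OF equiv_net_rel int, symmetric])
      qed
      \<comment> \<open>An actual member is required: all classes in the union agree with that of
        \<open>a\<close>, but an empty union would be the empty set.\<close>
      have "(\<lambda>\<epsilon> y. v \<epsilon> y * u \<epsilon> y) \<in> GS_mult V U"
        unfolding GS_mult_def using \<open>v \<in> V\<close> u(1) vu by auto
      then show ?thesis unfolding GS_integral_def using eq by auto
    qed
    moreover have "point_value U X \<in> C_tilde"
      unfolding pv C_tilde_def by (rule quotientI[OF a])
    ultimately show ?thesis using pv by simp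
  qed
  ultimately show ?thesis by blast
qed

end
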